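(* Let $t=t(n)$ be a sequence of positive integers. Let $A=A_n\subseteq[n]$ be sets with $|A|=\lceil \frac{n}{2}\rceil+t$ and let $q=q(n)$ be a sequence of probabilities with $q=\omega(n^{-1})$ such that whp $A\cup[n]_q$ is not Schur. Then either $\left|\left[\lceil \tfrac n2\rceil, n\right]\setminus A\right|=O(q^{-1})$ or $A$ contains $O(q^{-2}n^{-1})$ even numbers. Precisely: there is a constant $K>0$ (not depending on $n$) such that for every sufficiently large $n$, either $\left|\left[\lceil \tfrac n2\rceil, n\right]\setminus A\right|\le Kq^{-1}$ or $A$ contains at most $Kq^{-2}n^{-1}$ even numbers.
   Context: $[n]=\{1,\dots,n\}$, and $[a,b]$ denotes the set of integers $i$ with $a\le i\le b$. For $q\in[0,1]$, $[n]_q$ denotes the random subset of $[n]$ obtained by including each element independently with probability $q$. A Schur triple in a set $A\subseteq\mathbb{N}$ is a triple $(x,y,z)\in A^3$ with $x+y=z$ (the case $x=y$ is allowed). A set $A\subseteq\mathbb{N}$ is called Schur if every colouring of the elements of $A$ with two colours contains a monochromatic Schur triple. All quantities depend on $n$ and asymptotics are as $n\to\infty$; $f=\omega(g)$ means $f/g\to\infty$. An event holds whp if its probability tends to $1$ as $n\to\infty$. *)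

theory Defs
  imports "HOL-Probability.Probability" "HOL-Library.Landau_Symbols"
begin

definition schur_triple :: "nat set \<Rightarrow> nat \<times> nat \<times> nat \<Rightarrow> bool" where
  "schur_triple A = (\<lambda>(x, y, z). x \<in> A \<and> y \<in> A \<and> z \<in> A \<and> x + y = z)"

text \<open>A two-colouring is a function to \<^typ>\<open>bool\<close>; its values outside the set are irrelevant.\<close>

definition schur :: "nat set \<Rightarrow> bool" where
  "schur A \<longleftrightarrow>
     (\<forall>c :: nat \<Rightarrow> bool. \<exists>x y z. schur_triple A (x, y, z) \<and> c x = c y \<and> c y = c z)"

text \<open>The binomial random subset of \<open>{1..n}\<close>. Note that \<^const>\<open>bernoulli_pmf\<close> clamps its
  parameter to the unit interval, so \<open>0 \<le> q \<le> 1\<close> has to be assumed separately.\<close>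

definition random_subset :: "nat \<Rightarrow> real \<Rightarrow> nat set pmf" where
  "random_subset n q =
     map_pmf (\<lambda>f. {i \<in> {1..n}. f i}) (Pi_pmf {1..n} False (\<lambda>_. bernoulli_pmf q))"

text \<open>\<open>E n\<close> is an event of the distribution \<open>p n\<close>.\<close>

definition whp :: "(nat \<Rightarrow> 'a pmf) \<Rightarrow> (nat \<Rightarrow> 'a set) \<Rightarrow> bool" where
  "whp p E \<longleftrightarrow> (\<lambda>n. measure_pmf.prob (p n) (E n)) \<longlonglongrightarrow> 1"

end

theory Submission
  imports Defs
begin

text \<open>A colouring of \<open>C\<close> colours the edges \<open>{u, v}\<close> with \<open>\<bar>u - v\<bar> \<in> C\<close> of a graph on the integers, and a
  monochromatic triangle is a monochromatic Schur triple. Suppose that the number \<open>m\<close> of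
  elements of \<open>[\<lceil>n/2\<rceil>, n]\<close> missing from \<open>A\<close> exceeds \<open>K q\<^sup>-\<^sup>1\<close> and that \<open>A\<close> has more than \<open>K q\<^sup>-\<^sup>2 n\<^sup>-\<^sup>1\<close> even elements.
  It suffices to show that \<open>A \<union> [n]\<^sub>q\<close> is Schur with probability at least \<open>1/2\<close>.

  If \<open>A\<close> has \<open>\<Omega>(n\<^sup>2)\<close> Schur triples, its graph contains many copies of \<open>K\<^bsub>2,2,2\<^esub>\<close>, and three independent
  random elements complete one of them to \<open>K\<^sub>6\<close>. Otherwise \<open>|A| > n/2\<close> forces \<open>A\<close> to be nearly all odd or
  nearly the upper half of \<open>[n]\<close>. In the odd case an even \<open>a \<in> A\<close> and random \<open>r\<close>, \<open>a \<plusminus> r\<close>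
  suffice. In the upper half case \<open>A\<close> has at least \<open>m\<close> elements below \<open>n/2\<close>: if many of them are
  at distance at least \<open>20 m\<close> from \<open>n/2\<close>, then such an \<open>a\<close> with random \<open>r\<close>, \<open>a + r\<close>, \<open>r \<le> 3 m\<close>, suffices;
  if not, \<open>A\<close> has \<open>\<Omega>(m\<^sup>2)\<close> Schur triples at scale \<open>m\<close> around \<open>(n/2, n/2, n)\<close>, and the
  \<open>K\<^sub>6\<close> argument applies at that scale. Second moments produce the random elements.\<close>

section \<open>Two Schur configurations\<close>

text \<open>Whatever the signs, one of |u|, |v|, |u - v| is the sum of the other two. Configurations
  can therefore be checked on signed integers without ordering the vertices.\<close>

lemma schurI:
  assumes "\<And>c :: nat \<Rightarrow> bool. \<exists>u v :: int. nat \<bar>u\<bar> \<in> C \<and> nat \<bar>v\<bar> \<in> C \<and> nat \<bar>u - v\<bar> \<in> C \<and>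
     c (nat \<bar>u\<bar>) = c (nat \<bar>v\<bar>) \<and> c (nat \<bar>v\<bar>) = c (nat \<bar>u - v\<bar>)"
  shows "schur C"
  unfolding schur_def
proof
  fix c :: "nat \<Rightarrow> bool"
  obtain u v :: int where uv: "nat \<bar>u\<bar> \<in> C" "nat \<bar>v\<bar> \<in> C" "nat \<bar>u - v\<bar> \<in> C"
    "c (nat \<bar>u\<bar>) = c (nat \<bar>v\<bar>)" "c (nat \<bar>v\<bar>) = c (nat \<bar>u - v\<bar>)"
    using assms[of c] by blast
  consider "nat \<bar>u - v\<bar> + nat \<bar>v\<bar> = nat \<bar>u\<bar>" | "nat \<bar>u - v\<bar> + nat \<bar>u\<bar> = nat \<bar>v\<bar>" | "nat \<bar>u\<bar> + nat \<bar>v\<bar> = nat \<bar>u - v\<bar>"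
    by linarith
  thus "\<exists>x y z. schur_triple C (x, y, z) \<and> c x = c y \<and> c y = c z"
    using uv unfolding schur_triple_def by cases (simp; metis)+
qed

text \<open>If \<open>r\<close> and \<open>w \<in> {a, a + r}\<close> get different colours, then the colours of \<open>x\<close> and \<open>x + w\<close> differ and
  are swapped by every step \<open>r\<close>, which clashes with the third element of \<open>{a, r, a + r}\<close>.\<close>

lemma schur_prism:
  fixes a r x :: int
  assumes "nat \<bar>a\<bar> \<in> C" "nat \<bar>r\<bar> \<in> C" "nat \<bar>a + r\<bar> \<in> C"
    and "\<And>d. d \<in> {0, r, 2 * r, a, a + r, a + 2 * r, a + 3 * r} \<Longrightarrow> nat \<bar>x + d\<bar> \<in> C"
  shows "schur C"
proof (rule schurI, rule ccontr)
  fix c :: "nat \<Rightarrow> bool"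
  assume *: "\<nexists>u v :: int. nat \<bar>u\<bar> \<in> C \<and> nat \<bar>v\<bar> \<in> C \<and> nat \<bar>u - v\<bar> \<in> C \<and>
     c (nat \<bar>u\<bar>) = c (nat \<bar>v\<bar>) \<and> c (nat \<bar>v\<bar>) = c (nat \<bar>u - v\<bar>)"
  define k where "k u = c (nat \<bar>u\<bar>)" for u :: int
  have E: "\<not> (k u = k v \<and> k v = k w)"
    if "nat \<bar>u\<bar> \<in> C" "nat \<bar>v\<bar> \<in> C" "nat \<bar>w\<bar> \<in> C" "u - v = w" for u v w
    using * that unfolding k_def by blast
  have p: "nat \<bar>x\<bar> \<in> C" "nat \<bar>x + r\<bar> \<in> C" "nat \<bar>x + 2 * r\<bar> \<in> C" "nat \<bar>x + a\<bar> \<in> C"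
    "nat \<bar>x + a + r\<bar> \<in> C" "nat \<bar>x + a + 2 * r\<bar> \<in> C" "nat \<bar>x + a + 3 * r\<bar> \<in> C"
    using assms(4)[of 0] assms(4)[of r] assms(4)[of "2 * r"] assms(4)[of a] assms(4)[of "a + r"]
      assms(4)[of "a + 2 * r"] assms(4)[of "a + 3 * r"] by (simp_all add: add.assoc)
  note q = p assms(1-3)
  \<comment> \<open>Colours alternate along steps \<open>r\<close>. The clashing pair
    (\<open>x\<close>, \<open>x + a + r\<close> if \<open>w = a\<close>, and \<open>x\<close>,
    \<open>x + a\<close> if \<open>w = a + r\<close>) thus reappears in the other colour one step
    later, so the clash occurs whatever the colour of the third element is.\<close>
  have "\<not> (k (a + r) = k a \<and> k a = k r)" by (rule E) (use q in auto)
  moreover have "\<not> (k (x + r) = k x \<and> k x = k r)" by (rule E) (use q in auto)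
  moreover have "\<not> (k (x + 2 * r) = k (x + r) \<and> k (x + r) = k r)" by (rule E) (use q in auto)
  moreover have "\<not> (k (x + a + r) = k (x + a) \<and> k (x + a) = k r)" by (rule E) (use q in auto)
  moreover have "\<not> (k (x + a + 2 * r) = k (x + a + r) \<and> k (x + a + r) = k r)" by (rule E) (use q in auto)
  moreover have "\<not> (k (x + a + 3 * r) = k (x + a + 2 * r) \<and> k (x + a + 2 * r) = k r)" by (rule E) (use q in auto)
  moreover have "\<not> (k (x + a) = k x \<and> k x = k a)" by (rule E) (use q in auto)
  moreover have "\<not> (k (x + a + r) = k (x + r) \<and> k (x + r) = k a)" by (rule E) (use q in auto)
  moreover have "\<not> (k (x + a + 2 * r) = k (x + 2 * r) \<and> k (x + 2 * r) = k a)" by (rule E) (use q in auto)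
  moreover have "\<not> (k (x + a + r) = k x \<and> k x = k (a + r))" by (rule E) (use q in auto)
  moreover have "\<not> (k (x + a + 2 * r) = k (x + r) \<and> k (x + r) = k (a + r))" by (rule E) (use q in auto)
  moreover have "\<not> (k (x + a + 3 * r) = k (x + 2 * r) \<and> k (x + 2 * r) = k (a + r))" by (rule E) (use q in auto)
  ultimately show False by argo
qed

text \<open>Ramsey's theorem \<open>R(3, 3) = 6\<close> for the complete graph on the six integers.\<close>

lemma schur_complete_6:
  fixes x1 x2 y1 y2 z1 z2 :: int
  assumes "nat \<bar>x1 - x2\<bar> \<in> C" "nat \<bar>y1 - y2\<bar> \<in> C" "nat \<bar>z1 - z2\<bar> \<in> C"
    and "\<And>x y. x \<in> {x1, x2} \<Longrightarrow> y \<in> {y1, y2} \<Longrightarrow> nat \<bar>y - x\<bar> \<in> C"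
    and "\<And>x z. x \<in> {x1, x2} \<Longrightarrow> z \<in> {z1, z2} \<Longrightarrow> nat \<bar>z - x\<bar> \<in> C"
    and "\<And>y z. y \<in> {y1, y2} \<Longrightarrow> z \<in> {z1, z2} \<Longrightarrow> nat \<bar>z - y\<bar> \<in> C"
  shows "schur C"
proof (rule schurI, rule ccontr)
  fix c :: "nat \<Rightarrow> bool"
  assume *: "\<nexists>u v :: int. nat \<bar>u\<bar> \<in> C \<and> nat \<bar>v\<bar> \<in> C \<and> nat \<bar>u - v\<bar> \<in> C \<and>
     c (nat \<bar>u\<bar>) = c (nat \<bar>v\<bar>) \<and> c (nat \<bar>v\<bar>) = c (nat \<bar>u - v\<bar>)"
  define k where "k u v = c (nat \<bar>u - v\<bar>)" for u v :: int
  have E: "\<not> (k u v = k v w \<and> k v w = k u w)"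
    if "nat \<bar>u - v\<bar> \<in> C" "nat \<bar>v - w\<bar> \<in> C" "nat \<bar>u - w\<bar> \<in> C" for u v w
  proof
    assume "k u v = k v w \<and> k v w = k u w"
    moreover have "(u - w) - (v - w) = u - v" by simp
    ultimately show False using * that unfolding k_def by (metis (no_types, opaque_lifting))
  qed
  have p: "nat \<bar>z1 - z2\<bar> \<in> C" "nat \<bar>z1 - y1\<bar> \<in> C" "nat \<bar>z1 - y2\<bar> \<in> C" "nat \<bar>z1 - x1\<bar> \<in> C" "nat \<bar>z1 - x2\<bar> \<in> C"
    "nat \<bar>z2 - y1\<bar> \<in> C" "nat \<bar>z2 - y2\<bar> \<in> C" "nat \<bar>z2 - x1\<bar> \<in> C" "nat \<bar>z2 - x2\<bar> \<in> C"
    "nat \<bar>y1 - y2\<bar> \<in> C" "nat \<bar>y1 - x1\<bar> \<in> C" "nat \<bar>y1 - x2\<bar> \<in> C" "nat \<bar>y2 - x1\<bar> \<in> C" "nat \<bar>y2 - x2\<bar> \<in> C"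
    "nat \<bar>x1 - x2\<bar> \<in> C"
    using assms by auto
  \<comment> \<open>All twenty triangles, with the vertices ordered z1, z2, y1, y2, x1, x2 so that
    every edge is oriented as in \<open>p\<close>.\<close>
  show False
    using E[OF p(1) p(6) p(2)] E[OF p(1) p(7) p(3)] E[OF p(1) p(8) p(4)] E[OF p(1) p(9) p(5)]
      E[OF p(2) p(10) p(3)] E[OF p(2) p(11) p(4)] E[OF p(2) p(12) p(5)]
      E[OF p(3) p(13) p(4)] E[OF p(3) p(14) p(5)] E[OF p(4) p(15) p(5)]
      E[OF p(6) p(10) p(7)] E[OF p(6) p(11) p(8)] E[OF p(6) p(12) p(9)]
      E[OF p(7) p(13) p(8)] E[OF p(7) p(14) p(9)] E[OF p(8) p(15) p(9)]
      E[OF p(10) p(13) p(11)] E[OF p(10) p(14) p(12)] E[OF p(11) p(15) p(12)] E[OF p(13) p(15) p(14)]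
    by argo
qed

section \<open>Random sets hit spread families\<close>

lemma finite_set_random_subset: "finite (set_pmf (random_subset n q))"
proof -
  have "set_pmf (random_subset n q) \<subseteq> Pow {1..n}"
    by (auto simp: random_subset_def)
  thus ?thesis by (rule finite_subset) simp
qed

lemma prob_random_subset_superset:
  assumes "S \<subseteq> {1..n}" "0 \<le> q" "q \<le> 1"
  shows "measure_pmf.prob (random_subset n q) {R. S \<subseteq> R} = q ^ card S"
proof -
  define B where "B i = (if i \<in> S then {True} else UNIV)" for i
  have "measure_pmf.prob (random_subset n q) {R. S \<subseteq> R} =
      measure_pmf.prob (Pi_pmf {1..n} False (\<lambda>_. bernoulli_pmf q)) {f. S \<subseteq> {i \<in> {1..n}. f i}}"
    by (simp add: random_subset_def vimage_def)
  also have "{f. S \<subseteq> {i \<in> {1..n}. f i}} = Pi {1..n} B"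
    using assms(1) by (auto simp: B_def Pi_def)
  also have "measure_pmf.prob (Pi_pmf {1..n} False (\<lambda>_. bernoulli_pmf q)) (Pi {1..n} B) =
      (\<Prod>i\<in>{1..n}. measure_pmf.prob (bernoulli_pmf q) (B i))"
    by (rule measure_Pi_pmf_Pi) simp
  also have "\<dots> = (\<Prod>i\<in>{1..n}. if i \<in> S then q else 1)"
    using assms by (intro prod.cong refl) (simp add: B_def measure_pmf_single)
  also have "\<dots> = q ^ card S"
    using assms(1) by (simp add: prod.If_cases Int_absorb1)
  finally show ?thesis .
qed

text \<open>Second moment method, with \<open>q\<close> to the power \<open>- card (F \<inter> G)\<close> bounded by the sum over all
  \<open>S \<subseteq> F \<inter> G\<close> of \<open>q\<close> to the power \<open>- card S\<close>.\<close>

lemma spread_family_hit: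
  fixes Fam :: "nat set set" and q \<kappa> :: real
  assumes q: "0 < q" "q \<le> 1" and \<kappa>: "0 \<le> \<kappa>"
    and Fam: "Fam \<noteq> {}" "\<And>F. F \<in> Fam \<Longrightarrow> F \<subseteq> {1..n} \<and> card F = k"
    and spread: "\<And>S. S \<noteq> {} \<Longrightarrow> S \<subseteq> {1..n} \<Longrightarrow> card S \<le> k \<Longrightarrow>
      real (card {F \<in> Fam. S \<subseteq> F}) \<le> \<kappa> * real (card Fam) * q ^ card S"
  shows "measure_pmf.prob (random_subset n q) {R. \<exists>F\<in>Fam. F \<subseteq> R} \<ge> 1 - 2 ^ k * \<kappa>"
proof -
  let ?p = "random_subset n q"
  define X :: "nat set \<Rightarrow> real" where "X R = (\<Sum>F\<in>Fam. indicator {R. F \<subseteq> R} R)" for R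
  have "Fam \<subseteq> Pow {1..n}" using Fam by auto
  hence fin: "finite Fam" by (rule finite_subset) simp
  define N where "N = real (card Fam)"
  have N: "N > 0" using fin Fam by (simp add: N_def card_gt_0_iff)
  have int: "integrable (measure_pmf ?p) f" for f :: "nat set \<Rightarrow> real"
    by (rule integrable_measure_pmf_finite) (rule finite_set_random_subset)
  have EX: "measure_pmf.expectation ?p X = N * q ^ k"
  proof -
    have "measure_pmf.expectation ?p X =
        (\<Sum>F\<in>Fam. measure_pmf.expectation ?p (indicator {R. F \<subseteq> R}))"
      unfolding X_def by (rule Bochner_Integration.integral_sum) (rule int)
    also have "\<dots> = (\<Sum>F\<in>Fam. q ^ k)"
      using Fam q by (intro sum.cong refl) (simp add: prob_random_subset_superset)
    finally show ?thesis by (simp add: N_def)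
  qed
  have EX2: "measure_pmf.expectation ?p (\<lambda>R. (X R)\<^sup>2) \<le> (N * q ^ k)\<^sup>2 * (1 + 2 ^ k * \<kappa>)"
  proof -
    have sq: "(X R)\<^sup>2 = (\<Sum>F\<in>Fam. \<Sum>G\<in>Fam. indicator {R. F \<union> G \<subseteq> R} R)" for R
      unfolding X_def power2_eq_square sum_product
      by (intro sum.cong refl) (auto simp: indicator_def)
    have "measure_pmf.expectation ?p (\<lambda>R. (X R)\<^sup>2) =
        (\<Sum>F\<in>Fam. measure_pmf.expectation ?p (\<lambda>R. \<Sum>G\<in>Fam. indicator {R. F \<union> G \<subseteq> R} R))"
      unfolding sq by (rule Bochner_Integration.integral_sum) (rule int)
    also have "\<dots> = (\<Sum>F\<in>Fam. \<Sum>G\<in>Fam. measure_pmf.expectation ?p (indicator {R. F \<union> G \<subseteq> R}))"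
      by (intro sum.cong refl Bochner_Integration.integral_sum) (rule int)
    also have "\<dots> = (\<Sum>F\<in>Fam. \<Sum>G\<in>Fam. q ^ card (F \<union> G))"
    proof (intro sum.cong refl)
      fix F G assume "F \<in> Fam" "G \<in> Fam"
      thus "measure_pmf.expectation ?p (indicator {R. F \<union> G \<subseteq> R}) = q ^ card (F \<union> G)"
        using Fam(2) q prob_random_subset_superset[of "F \<union> G" n q] by simp
    qed
    also have "\<dots> \<le> (\<Sum>F\<in>Fam. q ^ (2 * k) * N * (1 + 2 ^ k * \<kappa>))"
    proof (intro sum_mono)
      fix F assume F: "F \<in> Fam"
      have finF: "finite F" using Fam(2)[OF F] finite_subset by blast
      have "(\<Sum>G\<in>Fam. q ^ card (F \<union> G)) \<le>
          (\<Sum>G\<in>Fam. \<Sum>S\<in>Pow F. if S \<subseteq> G then q ^ (2 * k - card S) else 0)"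
      proof (intro sum_mono)
        fix G assume G: "G \<in> Fam"
        have finG: "finite G" using Fam(2)[OF G] finite_subset by blast
        have "card (F \<union> G) + card (F \<inter> G) = 2 * k"
          using card_Un_Int[OF finF finG] Fam(2)[OF F] Fam(2)[OF G] by simp
        hence "q ^ card (F \<union> G) = (if F \<inter> G \<subseteq> G then q ^ (2 * k - card (F \<inter> G)) else 0)"
          by (metis add_diff_cancel_right' inf_le2)
        also have "\<dots> \<le> (\<Sum>S\<in>Pow F. if S \<subseteq> G then q ^ (2 * k - card S) else 0)"
          by (rule member_le_sum) (use finF q in auto)
        finally show "q ^ card (F \<union> G) \<le> \<dots>" .
      qed
      also have "\<dots> = (\<Sum>S\<in>Pow F. \<Sum>G\<in>Fam. if S \<subseteq> G then q ^ (2 * k - card S) else 0)"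
        by (rule sum.swap)
      also have "\<dots> = (\<Sum>S\<in>Pow F. real (card {G \<in> Fam. S \<subseteq> G}) * q ^ (2 * k - card S))"
        using fin by (intro sum.cong refl) (simp add: sum.If_cases Int_def)
      \<comment> \<open>After summation over \<open>F\<close>, the term \<open>S = {}\<close> yields
        the square of the mean; the nonempty \<open>S\<close> bound the variance.\<close>
      also have "\<dots> = real (card {G \<in> Fam. {} \<subseteq> G}) * q ^ (2 * k - card ({} :: nat set)) +
          (\<Sum>S\<in>Pow F - {{}}. real (card {G \<in> Fam. S \<subseteq> G}) * q ^ (2 * k - card S))"
        by (rule sum.remove) (use finF in auto)
      also have "\<dots> \<le> N * q ^ (2 * k) + (\<Sum>S\<in>Pow F - {{}}. \<kappa> * N * q ^ (2 * k))"
      proof (intro add_mono sum_mono)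
        fix S assume S: "S \<in> Pow F - {{}}"
        have le: "card S \<le> k" using S card_mono[OF finF] Fam(2)[OF F] by auto
        have "real (card {G \<in> Fam. S \<subseteq> G}) * q ^ (2 * k - card S) \<le>
            (\<kappa> * N * q ^ card S) * q ^ (2 * k - card S)"
          using spread[of S] S Fam(2)[OF F] le q by (intro mult_right_mono) (auto simp: N_def)
        also have "\<dots> = \<kappa> * N * q ^ (2 * k)"
          using le by (simp add: mult.assoc flip: power_add)
        finally show "real (card {G \<in> Fam. S \<subseteq> G}) * q ^ (2 * k - card S) \<le> \<kappa> * N * q ^ (2 * k)" .
      qed (simp add: N_def)
      also have "\<dots> \<le> N * q ^ (2 * k) + 2 ^ k * (\<kappa> * N * q ^ (2 * k))"
      proof -
        have "real (card (Pow F - {{}})) \<le> 2 ^ k"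
          using Fam(2)[OF F] finF by (simp add: card_Pow of_nat_diff)
        thus ?thesis using \<kappa> N q by (auto intro!: mult_right_mono)
      qed
      finally show "(\<Sum>G\<in>Fam. q ^ card (F \<union> G)) \<le> q ^ (2 * k) * N * (1 + 2 ^ k * \<kappa>)"
        by (simp add: algebra_simps)
    qed
    also have "\<dots> = (N * q ^ k)\<^sup>2 * (1 + 2 ^ k * \<kappa>)"
      by (simp add: N_def power_mult_distrib power2_eq_square power_mult[symmetric] mult_2 power_add)
    finally show ?thesis .
  qed
  define \<mu> where "\<mu> = N * q ^ k"
  have \<mu>: "\<mu> > 0" using N q by (simp add: \<mu>_def)
  have var: "measure_pmf.variance ?p X \<le> \<mu>\<^sup>2 * (2 ^ k * \<kappa>)"
    using EX2 by (subst measure_pmf.variance_eq) (auto simp: EX int \<mu>_def algebra_simps)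
  \<comment> \<open>If \<open>R\<close> contains no member of \<open>Fam\<close>, then
    \<open>X R = 0\<close> deviates from the mean by the full \<open>\<mu>\<close>, and Chebyshev's
    inequality applies.\<close>
  have "measure_pmf.prob ?p (- {R. \<exists>F\<in>Fam. F \<subseteq> R}) \<le>
      measure_pmf.prob ?p {R \<in> space (measure_pmf ?p). \<bar>X R - measure_pmf.expectation ?p X\<bar> \<ge> \<mu>}"
  proof (rule measure_pmf.finite_measure_mono)
    show "- {R. \<exists>F\<in>Fam. F \<subseteq> R} \<subseteq> {R \<in> space (measure_pmf ?p). \<bar>X R - measure_pmf.expectation ?p X\<bar> \<ge> \<mu>}"
    proof
      fix R assume "R \<in> - {R. \<exists>F\<in>Fam. F \<subseteq> R}"
      hence "X R = 0" by (auto simp: X_def intro!: sum.neutral)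
      thus "R \<in> {R \<in> space (measure_pmf ?p). \<bar>X R - measure_pmf.expectation ?p X\<bar> \<ge> \<mu>}"
        using \<mu> by (simp add: EX \<mu>_def)
    qed
  qed simp
  also have "\<dots> \<le> measure_pmf.variance ?p X / \<mu>\<^sup>2"
    by (rule measure_pmf.Chebyshev_inequality) (use \<mu> int in auto)
  also have "\<dots> \<le> 2 ^ k * \<kappa>"
    using var \<mu> by (simp add: divide_le_eq mult.commute)
  finally show ?thesis
    using measure_pmf.prob_compl[of "{R. \<exists>F\<in>Fam. F \<subseteq> R}" ?p]
    by (simp add: Compl_eq_Diff_UNIV)
qed

section \<open>Dense triangles and complete graphs\<close>

text \<open>Cauchy-Schwarz over \<open>b\<close>, then expansion of the inner square. One
  application doubles the variable \<open>a\<close> and keeps all variables collected in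
  \<open>b\<close>.\<close>

lemma sum_square_le_doubled:
  fixes f :: "'a \<Rightarrow> 'b \<Rightarrow> real"
  assumes "finite A" "finite B"
  shows "(\<Sum>a\<in>A. \<Sum>b\<in>B. f a b)\<^sup>2 \<le> real (card B) * (\<Sum>a\<in>A. \<Sum>a'\<in>A. \<Sum>b\<in>B. f a b * f a' b)"
proof -
  have "(\<Sum>a\<in>A. \<Sum>b\<in>B. f a b)\<^sup>2 = (\<Sum>b\<in>B. \<Sum>a\<in>A. f a b)\<^sup>2"
    by (subst sum.swap) simp
  also have "\<dots> \<le> (\<Sum>b\<in>B. (\<Sum>a\<in>A. f a b)\<^sup>2) * real (card B)"
    by (rule sum_squared_le_sum_of_squares)
  also have "(\<Sum>b\<in>B. (\<Sum>a\<in>A. f a b)\<^sup>2) = (\<Sum>b\<in>B. \<Sum>a\<in>A. \<Sum>a'\<in>A. f a b * f a' b)"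
    by (simp add: power2_eq_square sum_product)
  also have "\<dots> = (\<Sum>a\<in>A. \<Sum>a'\<in>A. \<Sum>b\<in>B. f a b * f a' b)"
    by (subst sum.swap) (intro sum.cong refl sum.swap)
  finally show ?thesis by (simp add: mult.commute)
qed

text \<open>Cauchy--Schwarz in each of the three coordinates.\<close>

lemma octahedra_lower_bound:
  fixes f :: "'a \<Rightarrow> 'a \<Rightarrow> 'a \<Rightarrow> real"
  assumes I: "finite I" and f: "\<And>x y z. f x y z \<ge> 0"
  shows "(\<Sum>x\<in>I. \<Sum>y\<in>I. \<Sum>z\<in>I. f x y z) ^ 8 \<le> real (card I) ^ 18 *
    (\<Sum>x\<in>I. \<Sum>x'\<in>I. \<Sum>y\<in>I. \<Sum>y'\<in>I. \<Sum>z\<in>I. \<Sum>z'\<in>I.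
       (f x y z * f x' y z * (f x y' z * f x' y' z)) *
       (f x y z' * f x' y z' * (f x y' z' * f x' y' z')))" (is "?S0 ^ 8 \<le> ?V ^ 18 * ?S3")
proof -
  define g where "g x x' y z = f x y z * f x' y z" for x x' y z
  define h where "h x x' y y' z = g x x' y z * g x x' y' z" for x x' y y' z
  define S1 where "S1 = (\<Sum>x\<in>I. \<Sum>x'\<in>I. \<Sum>y\<in>I. \<Sum>z\<in>I. g x x' y z)"
  define S2 where "S2 = (\<Sum>x\<in>I. \<Sum>x'\<in>I. \<Sum>y\<in>I. \<Sum>y'\<in>I. \<Sum>z\<in>I. h x x' y y' z)"
  have S3: "?S3 = (\<Sum>x\<in>I. \<Sum>x'\<in>I. \<Sum>y\<in>I. \<Sum>y'\<in>I. \<Sum>z\<in>I. \<Sum>z'\<in>I. h x x' y y' z * h x x' y y' z')"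
    by (simp add: h_def g_def)
  have 1: "?S0\<^sup>2 \<le> ?V ^ 2 * S1"
    using sum_square_le_doubled[of I "I \<times> I" "\<lambda>x (y, z). f x y z"] I
    by (simp add: S1_def g_def sum.cartesian_product' power2_eq_square)
  \<comment> \<open>Reordering brings the variable to be doubled next to the outside; the same
    happens below for \<open>S2\<close> and \<open>z\<close>.\<close>
  have S1': "S1 = (\<Sum>y\<in>I. \<Sum>(x, x', z)\<in>I \<times> I \<times> I. g x x' y z)"
  proof -
    have "S1 = (\<Sum>x\<in>I. \<Sum>y\<in>I. \<Sum>x'\<in>I. \<Sum>z\<in>I. g x x' y z)"
      unfolding S1_def by (intro sum.cong refl sum.swap)
    also have "\<dots> = (\<Sum>y\<in>I. \<Sum>x\<in>I. \<Sum>x'\<in>I. \<Sum>z\<in>I. g x x' y z)"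
      by (rule sum.swap)
    finally show ?thesis by (simp add: sum.cartesian_product')
  qed
  have S2': "S2 = (\<Sum>y\<in>I. \<Sum>y'\<in>I. \<Sum>(x, x', z)\<in>I \<times> I \<times> I. g x x' y z * g x x' y' z)"
  proof -
    have "S2 = (\<Sum>x\<in>I. \<Sum>y\<in>I. \<Sum>x'\<in>I. \<Sum>y'\<in>I. \<Sum>z\<in>I. h x x' y y' z)"
      unfolding S2_def by (intro sum.cong refl sum.swap)
    also have "\<dots> = (\<Sum>x\<in>I. \<Sum>y\<in>I. \<Sum>y'\<in>I. \<Sum>x'\<in>I. \<Sum>z\<in>I. h x x' y y' z)"
      by (intro sum.cong refl sum.swap)
    also have "\<dots> = (\<Sum>y\<in>I. \<Sum>x\<in>I. \<Sum>y'\<in>I. \<Sum>x'\<in>I. \<Sum>z\<in>I. h x x' y y' z)"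
      by (rule sum.swap)
    also have "\<dots> = (\<Sum>y\<in>I. \<Sum>y'\<in>I. \<Sum>x\<in>I. \<Sum>x'\<in>I. \<Sum>z\<in>I. h x x' y y' z)"
      by (intro sum.cong refl sum.swap)
    finally show ?thesis by (simp add: sum.cartesian_product' h_def)
  qed
  have 2: "S1\<^sup>2 \<le> ?V ^ 3 * S2"
    using sum_square_le_doubled[of I "I \<times> I \<times> I" "\<lambda>y (x, x', z). g x x' y z"] I
    unfolding S1' S2' by (simp add: case_prod_beta power3_eq_cube mult.assoc)
  have S2'': "S2 = (\<Sum>z\<in>I. \<Sum>(x, x', y, y')\<in>I \<times> I \<times> I \<times> I. h x x' y y' z)"
  proof -
    have "S2 = (\<Sum>(x, x', y, y')\<in>I \<times> I \<times> I \<times> I. \<Sum>z\<in>I. h x x' y y' z)"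
      unfolding S2_def by (simp add: sum.cartesian_product')
    thus ?thesis unfolding case_prod_beta by (subst (asm) sum.swap)
  qed
  have S3': "?S3 = (\<Sum>z\<in>I. \<Sum>z'\<in>I. \<Sum>(x, x', y, y')\<in>I \<times> I \<times> I \<times> I. h x x' y y' z * h x x' y y' z')"
  proof -
    have "?S3 = (\<Sum>(x, x', y, y')\<in>I \<times> I \<times> I \<times> I. \<Sum>z\<in>I. \<Sum>z'\<in>I. h x x' y y' z * h x x' y y' z')"
      unfolding S3 by (simp add: sum.cartesian_product')
    also have "\<dots> = (\<Sum>z\<in>I. \<Sum>(x, x', y, y')\<in>I \<times> I \<times> I \<times> I. \<Sum>z'\<in>I. h x x' y y' z * h x x' y y' z')"
      unfolding case_prod_beta by (rule sum.swap)
    also have "\<dots> = (\<Sum>z\<in>I. \<Sum>z'\<in>I. \<Sum>(x, x', y, y')\<in>I \<times> I \<times> I \<times> I. h x x' y y' z * h x x' y y' z')"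
      unfolding case_prod_beta by (intro sum.cong refl sum.swap)
    finally show ?thesis .
  qed
  have 3: "S2\<^sup>2 \<le> ?V ^ 4 * ?S3"
    using sum_square_le_doubled[of I "I \<times> I \<times> I \<times> I" "\<lambda>z (x, x', y, y'). h x x' y y' z"] I
    unfolding S2'' S3' by (simp add: case_prod_beta power4_eq_xxxx mult.assoc)
  \<comment> \<open>The three steps cost the factors \<open>V^2\<close>, \<open>V^3\<close>,
    \<open>V^4\<close> and enter with powers 4, 2, 1, which gives the exponent 8 + 6 + 4 =
    18.\<close>
  have "?S0 ^ 8 = (?S0\<^sup>2) ^ 4" by (simp add: power_mult[symmetric])
  also have "\<dots> \<le> (?V ^ 2 * S1) ^ 4" by (rule power_mono[OF 1]) simp
  also have "\<dots> = ?V ^ 8 * (S1\<^sup>2)\<^sup>2" by (simp add: power_mult_distrib power_mult[symmetric])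
  also have "\<dots> \<le> ?V ^ 8 * (?V ^ 3 * S2)\<^sup>2"
    by (intro mult_left_mono power_mono[OF 2]) auto
  also have "\<dots> = ?V ^ 14 * S2\<^sup>2" by (simp add: power_mult_distrib power_mult[symmetric] power_add[symmetric])
  also have "\<dots> \<le> ?V ^ 14 * (?V ^ 4 * ?S3)"
    by (intro mult_left_mono 3) auto
  also have "\<dots> = ?V ^ 18 * ?S3" by (simp add: mult.assoc[symmetric] power_add[symmetric])
  finally show ?thesis .
qed

lemma schur_mono:
  assumes "schur A" "A \<subseteq> B"
  shows "schur B"
  unfolding schur_def
proof
  fix c :: "nat \<Rightarrow> bool"
  obtain x y z where "schur_triple A (x, y, z)" "c x = c y" "c y = c z"
    using assms(1) unfolding schur_def by blast
  moreover from this(1) have "schur_triple B (x, y, z)"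
    using assms(2) by (auto simp: schur_triple_def)
  ultimately show "\<exists>x y z. schur_triple B (x, y, z) \<and> c x = c y \<and> c y = c z" by blast
qed

text \<open>Each of the six degeneracies, a zero entry or two equal entries, leaves two free
  coordinates; \<open>F i\<close> parametrises the i-th one. The remaining triples are those whose
  entries form a set of three positive lengths.\<close>

lemma card_degenerate_triples_le:
  "card {(a, b, c) \<in> {..<V} \<times> {..<V} \<times> {..<V :: nat}. \<not> (0 < a \<and> 0 < b \<and> 0 < c \<and> a \<noteq> b \<and> a \<noteq> c \<and> b \<noteq> c)}
     \<le> 6 * V ^ 2" (is "card ?D \<le> _")
proof -
  define J where "J = {..<V} \<times> {..<V}"
  define F where "F = (\<lambda>i :: nat. \<lambda>(u, v). [(0, u, v), (u, 0, v), (u, v, 0), (u, u, v), (u, v, u), (v, u, u :: nat)] ! i)"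
  have J: "finite J" "card J = V ^ 2" by (simp_all add: J_def card_cartesian_product power2_eq_square)
  have "?D \<subseteq> (\<Union>i<6. F i ` J)"
  proof
    fix w assume w: "w \<in> ?D"
    obtain a b c where w_eq: "w = (a, b, c)" by (cases w) auto
    have abc: "a \<in> {..<V}" "b \<in> {..<V}" "c \<in> {..<V}"
      and "\<not> (0 < a \<and> 0 < b \<and> 0 < c \<and> a \<noteq> b \<and> a \<noteq> c \<and> b \<noteq> c)"
      using w unfolding w_eq by auto
    then consider "a = 0" | "b = 0" | "c = 0" | "a = b" | "a = c" | "b = c" by fast
    then obtain i where "i < 6" "(a, b, c) \<in> {F i (a, b), F i (a, c), F i (b, c), F i (b, a)}"
    proof cases
      case 1 thus ?thesis by (intro that[of 0]) (simp_all add: F_def)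
    next
      case 2 thus ?thesis by (intro that[of 1]) (simp_all add: F_def)
    next
      case 3 thus ?thesis by (intro that[of 2]) (simp_all add: F_def)
    next
      case 4 thus ?thesis by (intro that[of 3]) (simp_all add: F_def)
    next
      case 5 thus ?thesis by (intro that[of 4]) (simp_all add: F_def)
    next
      case 6 thus ?thesis by (intro that[of 5]) (simp_all add: F_def)
    qed
    thus "w \<in> (\<Union>i<6. F i ` J)" using abc unfolding w_eq J_def by blast
  qed
  hence "card ?D \<le> card (\<Union>i<6. F i ` J)"
    by (rule card_mono[rotated]) (use J in auto)
  also have "\<dots> \<le> (\<Sum>i<6. card (F i ` J))" by (rule card_UN_le) simp
  also have "\<dots> \<le> (\<Sum>i<6::nat. V ^ 2)"
    by (intro sum_mono) (use J card_image_le in metis)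
  finally show ?thesis by simp
qed

text \<open>The previous inequality for the indicator function of \<open>T\<close>. The two vertices
  chosen in a class may coincide.\<close>

lemma card_octahedra:
  fixes T :: "('a \<times> 'a \<times> 'a) set"
  assumes I: "finite I" "T \<subseteq> I \<times> I \<times> I"
  shows "real (card T) ^ 8 \<le> real (card I) ^ 18 *
    real (card {(x, x', y, y', z, z'). {x, x'} \<times> {y, y'} \<times> {z, z'} \<subseteq> T})"
proof -
  let ?Q = "{(x, x', y, y', z, z'). {x, x'} \<times> {y, y'} \<times> {z, z'} \<subseteq> T}"
  let ?I6 = "I \<times> I \<times> I \<times> I \<times> I \<times> I"
  have Q: "?Q = {w \<in> ?I6. case w of (x, x', y, y', z, z') \<Rightarrow> {x, x'} \<times> {y, y'} \<times> {z, z'} \<subseteq> T}"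
  proof (intro set_eqI iffI)
    fix w assume "w \<in> ?Q"
    moreover obtain x x' y y' z z' where w: "w = (x, x', y, y', z, z')" by (cases w) auto
    ultimately have "(x, y, z) \<in> T" "(x', y', z') \<in> T" by auto
    hence "w \<in> ?I6" using I(2) unfolding w by blast
    thus "w \<in> {w \<in> ?I6. case w of (x, x', y, y', z, z') \<Rightarrow> {x, x'} \<times> {y, y'} \<times> {z, z'} \<subseteq> T}"
      using \<open>w \<in> ?Q\<close> by blast
  qed blast
  define f where "f x y z = (of_bool ((x, y, z) \<in> T) :: real)" for x y z
  have T: "T = {w \<in> I \<times> I \<times> I. w \<in> T}" using I by auto
  have "real (card T) = (\<Sum>w\<in>I \<times> I \<times> I. of_bool (w \<in> T))"
    using I by (subst T) (simp add: Int_def)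
  hence 1: "real (card T) = (\<Sum>x\<in>I. \<Sum>y\<in>I. \<Sum>z\<in>I. f x y z)"
    by (simp add: sum.cartesian_product' f_def)
  have "real (card ?Q) = (\<Sum>w\<in>?I6. of_bool (case w of (x, x', y, y', z, z') \<Rightarrow> {x, x'} \<times> {y, y'} \<times> {z, z'} \<subseteq> T))"
    unfolding Q using I by (simp add: Int_def)
  also have "\<dots> = (\<Sum>x\<in>I. \<Sum>x'\<in>I. \<Sum>y\<in>I. \<Sum>y'\<in>I. \<Sum>z\<in>I. \<Sum>z'\<in>I.
       of_bool ({x, x'} \<times> {y, y'} \<times> {z, z'} \<subseteq> T))"
    by (simp add: sum.cartesian_product' del: insert_subset)
  also have "\<dots> = (\<Sum>x\<in>I. \<Sum>x'\<in>I. \<Sum>y\<in>I. \<Sum>y'\<in>I. \<Sum>z\<in>I. \<Sum>z'\<in>I.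
       (f x y z * f x' y z * (f x y' z * f x' y' z)) *
       (f x y z' * f x' y z' * (f x y' z' * f x' y' z')))"
  proof (intro sum.cong refl)
    fix x x' y y' z z'
    have "({x, x'} \<times> {y, y'} \<times> {z, z'} \<subseteq> T) \<longleftrightarrow>
        (((x, y, z) \<in> T \<and> (x', y, z) \<in> T) \<and> (x, y', z) \<in> T \<and> (x', y', z) \<in> T) \<and>
        ((x, y, z') \<in> T \<and> (x', y, z') \<in> T) \<and> (x, y', z') \<in> T \<and> (x', y', z') \<in> T"
      by blast
    thus "of_bool ({x, x'} \<times> {y, y'} \<times> {z, z'} \<subseteq> T) =
       (f x y z * f x' y z * (f x y' z * f x' y' z)) *
       (f x y z' * f x' y z' * (f x y' z' * f x' y' z'))"
      by (simp only: f_def of_bool_conj)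
  qed
  finally show ?thesis
    unfolding 1 using octahedra_lower_bound[OF I(1), of f] unfolding f_def by simp
qed

text \<open>The vertices of the tripartite graph are \<open>x\<close>, \<open>p1 + y\<close> and \<open>p1 + p2 + z\<close>. Only the three edges inside
  the parts of an octahedron are random, so their lengths are independent.\<close>

lemma dense_triangles_hit:
  fixes p1 p2 :: int and T :: "(nat \<times> nat \<times> nat) set" and \<tau> q :: real
  assumes q: "0 < q" "q \<le> 1" and V: "V \<le> n + 1" and \<tau>: "\<tau> > 0"
    and T: "T \<subseteq> {..<V} \<times> {..<V} \<times> {..<V}" "real (card T) \<ge> \<tau> * real V ^ 3"
    and edges: "\<And>x y z. (x, y, z) \<in> T \<Longrightarrow> nat \<bar>p1 + int y - int x\<bar> \<in> A \<and>
       nat \<bar>p2 + int z - int y\<bar> \<in> A \<and> nat \<bar>p1 + p2 + int z - int x\<bar> \<in> A"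
    and large: "real V * q \<ge> 6912 / \<tau> ^ 8"
  shows "measure_pmf.prob (random_subset n q) {R. schur (A \<union> R)} \<ge> 1 / 2"
proof -
  let ?I = "{..<V}"
  define dd :: "nat \<Rightarrow> nat \<Rightarrow> nat" where "dd x y = nat \<bar>int x - int y\<bar>" for x y
  define Q where "Q = {(x, x', y, y', z, z'). {x, x'} \<times> {y, y'} \<times> {z, z'} \<subseteq> T}"
  define \<phi> where "\<phi> = (\<lambda>(x, x', y, y', z, z'). (dd x x', dd y y', dd z z'))"
  define R3 where "R3 = \<phi> ` Q"
  define D where "D = {(a, b, c) \<in> ?I \<times> ?I \<times> ?I. \<not> (0 < a \<and> 0 < b \<and> 0 < c \<and> a \<noteq> b \<and> a \<noteq> c \<and> b \<noteq> c)}"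
  define Fam where "Fam = (\<lambda>(a, b, c). {a, b, c}) ` (R3 - D)"
  have Vpos: "V > 0"
  proof (rule ccontr)
    assume "\<not> V > 0"
    hence "6912 / \<tau> ^ 8 \<le> 0" using large by simp
    moreover have "6912 / \<tau> ^ 8 > 0" using \<tau> by simp
    ultimately show False by linarith
  qed
  have QI: "Q \<subseteq> ?I \<times> ?I \<times> ?I \<times> ?I \<times> ?I \<times> ?I"
    using T(1) unfolding Q_def by fastforce
  have ddI: "dd x y \<in> ?I" if "x \<in> ?I" "y \<in> ?I" for x y using that by (auto simp: dd_def)
  have finR3: "finite R3" unfolding R3_def by (rule finite_imageI, rule finite_subset[OF QI]) simp
  have R3I: "R3 \<subseteq> ?I \<times> ?I \<times> ?I"
    using QI ddI by (fastforce simp: R3_def \<phi>_def)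
  \<comment> \<open>An octahedron is recovered from its three lengths, one vertex in each part and
    the direction of each length, so at most \<open>8 V^3\<close> octahedra share a triple of
    lengths.\<close>
  have "card Q \<le> card ((R3 \<times> (?I \<times> ?I \<times> ?I)) \<times> (UNIV :: (bool \<times> bool \<times> bool) set))"
  proof (rule card_inj_on_le)
    let ?h = "\<lambda>(x, x', y, y', z, z'). ((\<phi> (x, x', y, y', z, z'), (x, y, z)), (x \<le> x', y \<le> y', z \<le> z'))"
    have inj: "dd x x' = dd x x'' \<Longrightarrow> (x \<le> x') = (x \<le> x'') \<Longrightarrow> x' = x''" for x x' x''
      by (auto simp: dd_def split: if_splits)
    show "inj_on ?h Q"
      by (rule inj_onI) (auto simp: \<phi>_def dest!: inj)
    show "?h ` Q \<subseteq> (R3 \<times> (?I \<times> ?I \<times> ?I)) \<times> UNIV"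
      using QI by (force simp: R3_def)
    show "finite ((R3 \<times> (?I \<times> ?I \<times> ?I)) \<times> (UNIV :: (bool \<times> bool \<times> bool) set))"
      using finR3 by simp
  qed
  also have "\<dots> = 8 * V ^ 3 * card R3"
    by (simp add: card_cartesian_product power3_eq_cube card_UNIV_bool flip: UNIV_Times_UNIV)
  finally have "real (card Q) \<le> real (8 * V ^ 3 * card R3)" by (rule of_nat_mono)
  hence Q_le: "real (card Q) \<le> 8 * real V ^ 3 * real (card R3)" by simp
  have V24: "real V ^ 24 = real V ^ 21 * real V ^ 3" by (simp flip: power_add)
  have "\<tau> ^ 8 * real V ^ 24 = (\<tau> * real V ^ 3) ^ 8"
    by (simp add: power_mult_distrib power_mult[symmetric])
  also have "\<dots> \<le> real (card T) ^ 8"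
    using T(2) \<tau> by (intro power_mono) auto
  also have "\<dots> \<le> real V ^ 18 * real (card Q)"
    using card_octahedra[OF _ T(1)] by (simp add: Q_def)
  also have "\<dots> \<le> real V ^ 18 * (8 * real V ^ 3 * real (card R3))"
    by (intro mult_left_mono Q_le) auto
  also have "\<dots> = real V ^ 21 * (8 * real (card R3))" by (simp add: power_add[symmetric])
  finally have "real V ^ 21 * (\<tau> ^ 8 * real V ^ 3) \<le> real V ^ 21 * (8 * real (card R3))"
    unfolding V24 by (simp only: mult_ac)
  hence R3_ge: "\<tau> ^ 8 * real V ^ 3 \<le> 8 * real (card R3)"
    using Vpos by simp
  have V_large: "real V * \<tau> ^ 8 \<ge> 6912"
  proof -
    have "real V * q \<le> real V" using q by (simp add: mult_left_le)
    hence "6912 / \<tau> ^ 8 \<le> real V" using large by linarith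
    thus ?thesis using \<tau> by (simp add: divide_le_eq)
  qed
  have D_le: "real (card D) \<le> 6 * real V ^ 2"
    using card_degenerate_triples_le[of V] unfolding D_def
    by (metis (no_types, lifting) of_nat_le_iff of_nat_mult of_nat_numeral of_nat_power)
  have finD: "finite D" unfolding D_def by (rule finite_subset[of _ "?I \<times> ?I \<times> ?I"]) auto
  \<comment> \<open>\<open>R3\<close> has at least \<open>\<tau>^8 V^3 / 8\<close> elements, and by
    \<open>V_large\<close> the at most \<open>6 V^2\<close> degenerate ones cost less than half of
    them.\<close>
  have diff_ge: "real (card (R3 - D)) \<ge> \<tau> ^ 8 * real V ^ 3 / 16"
  proof -
    have "card R3 \<le> card (R3 - D) + card D"
      using card_Un_le[of "R3 - D" D] card_mono[of "R3 - D \<union> D" R3] finR3 finD by fastforce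
    hence "real (card R3) \<le> real (card (R3 - D)) + real (card D)" by (metis of_nat_add of_nat_le_iff)
    moreover have "6912 * real V ^ 2 \<le> (real V * \<tau> ^ 8) * real V ^ 2"
      by (intro mult_right_mono V_large) auto
    hence "6912 * real V ^ 2 \<le> \<tau> ^ 8 * real V ^ 3" by (simp add: power2_eq_square power3_eq_cube mult_ac)
    ultimately show ?thesis using R3_ge D_le by linarith
  qed
  have Fam: "F \<subseteq> {1..n} \<and> card F = 3 \<and> F \<subseteq> {1..<V}" if F: "F \<in> Fam" for F
  proof -
    obtain a b c where abc: "F = {a, b, c}" "(a, b, c) \<in> R3" "(a, b, c) \<notin> D"
      using F by (auto simp: Fam_def)
    have "a < V" "b < V" "c < V" using abc R3I by auto
    moreover have "0 < a" "0 < b" "0 < c" "a \<noteq> b" "a \<noteq> c" "b \<noteq> c"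
      using abc calculation by (auto simp: D_def)
    ultimately show ?thesis using abc V by (auto simp: card_insert_if)
  qed
  have finFam: "finite Fam" unfolding Fam_def using finR3 by simp
  have finF: "finite F" if "F \<in> Fam" for F
    using Fam[OF that] finite_subset[of F "{1..n}"] by simp
  \<comment> \<open>Forgetting the order merges at most the 27 triples of
    \<open>F \<times> F \<times> F\<close>, and 432 = 27 * 16.\<close>
  have Fam_ge: "real (card Fam) \<ge> \<tau> ^ 8 / 432 * real V ^ 3"
  proof -
    have "R3 - D \<subseteq> (\<Union>F\<in>Fam. F \<times> F \<times> F)" by (force simp: Fam_def)
    hence "card (R3 - D) \<le> card (\<Union>F\<in>Fam. F \<times> F \<times> F)"
      by (rule card_mono[rotated]) (use finFam finF in auto)
    also have "\<dots> \<le> (\<Sum>F\<in>Fam. card (F \<times> F \<times> F))" by (rule card_UN_le[OF finFam])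
    also have "\<dots> = (\<Sum>F\<in>Fam. 27)"
      using Fam by (intro sum.cong refl) (simp add: card_cartesian_product)
    also have "\<dots> = 27 * card Fam" by simp
    finally have "real (card (R3 - D)) \<le> real (27 * card Fam)" by (rule of_nat_mono)
    thus ?thesis using diff_ge by simp
  qed
  have Vq: "real V * q > 0" using Vpos q by simp
  \<comment> \<open>With this value the bound \<open>V^2\<close> on the members through one element
    is just enough. Since 6912 = 16 * 432, it is at most 1/16, and the failure probability
    \<open>2^3 * \<kappa>\<close> is at most 1/2.\<close>
  define \<kappa> where "\<kappa> = 432 / (\<tau> ^ 8 * (real V * q))"
  have \<kappa>: "0 \<le> \<kappa>" using Vq \<tau> by (simp add: \<kappa>_def)
  have \<kappa>_le: "\<kappa> \<le> 1 / 16"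
  proof -
    have "6912 \<le> \<tau> ^ 8 * (real V * q)"
      using large \<tau> by (simp add: divide_le_eq mult_ac)
    thus ?thesis using Vq \<tau> unfolding \<kappa>_def by (subst divide_le_eq) auto
  qed
  have Fam0: "Fam \<noteq> {}"
  proof
    assume "Fam = {}"
    hence "\<tau> ^ 8 / 432 * real V ^ 3 \<le> 0" using Fam_ge by simp
    moreover have "\<tau> ^ 8 / 432 * real V ^ 3 > 0" using \<tau> Vpos by simp
    ultimately show False by linarith
  qed
  have "1 - 2 ^ 3 * \<kappa> \<le> measure_pmf.prob (random_subset n q) {R. \<exists>F\<in>Fam. F \<subseteq> R}"
  proof (rule spread_family_hit[OF q \<kappa> Fam0])
    show "F \<subseteq> {1..n} \<and> card F = 3" if "F \<in> Fam" for F using Fam[OF that] by blast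
    fix S :: "nat set"
    assume S: "S \<noteq> {}" "S \<subseteq> {1..n}" "card S \<le> 3"
    have finS: "finite S" using S finite_subset by blast
    have cS: "card S \<ge> 1" using S finS by (simp add: Suc_leI card_gt_0_iff)
    have "card {F \<in> Fam. S \<subseteq> F} \<le> card {G. G \<subseteq> {1..<V} \<and> card G = 3 - card S}"
    proof (rule card_inj_on_le)
      show "inj_on (\<lambda>F. F - S) {F \<in> Fam. S \<subseteq> F}" by (rule inj_onI) blast
      show "(\<lambda>F. F - S) ` {F \<in> Fam. S \<subseteq> F} \<subseteq> {G. G \<subseteq> {1..<V} \<and> card G = 3 - card S}"
        using Fam finS by (fastforce simp: card_Diff_subset)
      show "finite {G. G \<subseteq> {1..<V} \<and> card G = 3 - card S}"
        by (rule finite_subset[of _ "Pow {1..<V}"]) auto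
    qed
    also have "\<dots> = (V - 1) choose (3 - card S)"
      using n_subsets[of "{1..<V}" "3 - card S"] by simp
    also have "\<dots> \<le> V ^ (3 - card S)"
    proof (cases "3 - card S \<le> V - 1")
      case True
      hence "(V - 1) choose (3 - card S) \<le> (V - 1) ^ (3 - card S)" by (rule binomial_le_pow)
      also have "\<dots> \<le> V ^ (3 - card S)" by (rule power_mono) auto
      finally show ?thesis .
    qed (simp add: binomial_eq_0)
    finally have "real (card {F \<in> Fam. S \<subseteq> F}) \<le> real (V ^ (3 - card S))" by (rule of_nat_mono)
    also have "\<dots> = real V ^ (3 - card S)" by simp
    \<comment> \<open>The inserted factor is at least 1 because \<open>V q \<ge> 1\<close>; it
      supplies the powers of \<open>q\<close> that the spread condition asks for.\<close>
    also have "\<dots> \<le> real V ^ (3 - card S) * (real V * q) ^ (card S - 1)"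
    proof -
      have "card T \<le> V ^ 3"
        using card_mono[OF _ T(1)] by (simp add: card_cartesian_product power3_eq_cube)
      hence "real (card T) \<le> real V ^ 3" by (metis of_nat_le_iff of_nat_power)
      hence "\<tau> * real V ^ 3 \<le> 1 * real V ^ 3" using T(2) by linarith
      hence "\<tau> \<le> 1" using Vpos by simp
      hence "\<tau> ^ 8 \<le> 1" using \<tau> by (simp add: power_le_one)
      hence "1 \<le> 6912 / \<tau> ^ 8" using \<tau> by simp
      hence "1 \<le> real V * q" using large by linarith
      hence "1 \<le> (real V * q) ^ (card S - 1)" by (rule one_le_power)
      from mult_left_mono[OF this, of "real V ^ (3 - card S)"] show ?thesis by simp
    qed
    also have "\<dots> = \<kappa> * (\<tau> ^ 8 / 432 * real V ^ 3) * q ^ card S"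
    proof -
      have "card S \<in> {1, 2, 3}" using cS S(3) by auto
      thus ?thesis using Vq \<tau> Vpos q
        by (auto simp: \<kappa>_def field_simps power2_eq_square power3_eq_cube eval_nat_numeral)
    qed
    also have "\<dots> \<le> \<kappa> * real (card Fam) * q ^ card S"
      by (intro mult_right_mono mult_left_mono Fam_ge \<kappa>) (use q in auto)
    finally show "real (card {F \<in> Fam. S \<subseteq> F}) \<le> \<kappa> * real (card Fam) * q ^ card S" .
  qed
  also have "\<dots> \<le> measure_pmf.prob (random_subset n q) {R. schur (A \<union> R)}"
  proof (rule measure_pmf.finite_measure_mono)
    have "schur (A \<union> F)" if F: "F \<in> Fam" for F
    proof -
      obtain x x' y y' z z' where w: "{x, x'} \<times> {y, y'} \<times> {z, z'} \<subseteq> T" "F = {dd x x', dd y y', dd z z'}"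
        using F by (auto simp: Fam_def R3_def \<phi>_def Q_def)
      show ?thesis
      proof (rule schur_complete_6)
        show "nat \<bar>int x - int x'\<bar> \<in> A \<union> F" "nat \<bar>(p1 + int y) - (p1 + int y')\<bar> \<in> A \<union> F"
          "nat \<bar>(p1 + p2 + int z) - (p1 + p2 + int z')\<bar> \<in> A \<union> F"
          using w(2) by (auto simp: dd_def)
      next
        fix u v assume "u \<in> {int x, int x'}" "v \<in> {p1 + int y, p1 + int y'}"
        then obtain a b where "u = int a" "v = p1 + int b" "a \<in> {x, x'}" "b \<in> {y, y'}" by auto
        thus "nat \<bar>v - u\<bar> \<in> A \<union> F" using w(1) edges[of a b z] by auto
      next
        fix u v assume "u \<in> {int x, int x'}" "v \<in> {p1 + p2 + int z, p1 + p2 + int z'}"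
        then obtain a b where "u = int a" "v = p1 + p2 + int b" "a \<in> {x, x'}" "b \<in> {z, z'}" by auto
        thus "nat \<bar>v - u\<bar> \<in> A \<union> F" using w(1) edges[of a y b] by auto
      next
        fix u v assume "u \<in> {p1 + int y, p1 + int y'}" "v \<in> {p1 + p2 + int z, p1 + p2 + int z'}"
        then obtain a b where "u = p1 + int a" "v = p1 + p2 + int b" "a \<in> {y, y'}" "b \<in> {z, z'}" by auto
        thus "nat \<bar>v - u\<bar> \<in> A \<union> F" using w(1) edges[of x a b] by (auto simp: algebra_simps)
      qed
    qed
    thus "{R. \<exists>F\<in>Fam. F \<subseteq> R} \<subseteq> {R. schur (A \<union> R)}"
      using schur_mono by blast
  qed simp
  finally show ?thesis using \<kappa>_le by simp
qed

section \<open>Hitting near the extremal sets\<close>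

text \<open>Second moments for the pairs \<open>{r, s a r}\<close>. Given \<open>a\<close>, either
  of the two entries fixes the pair, so one element lies in at most \<open>2 * card E\<close> pairs.
  The first bound in \<open>large\<close> handles single elements, the second one whole
  pairs.\<close>

lemma pair_family_hit:
  fixes s :: "nat \<Rightarrow> nat \<Rightarrow> nat" and q :: real
  assumes q: "0 < q" "q \<le> 1" and fin: "finite E" "finite T"
    and rs: "\<And>a r. a \<in> E \<Longrightarrow> r \<in> T \<Longrightarrow> {r, s a r} \<subseteq> {1..n} \<and> r \<noteq> s a r"
    and inj: "\<And>a. a \<in> E \<Longrightarrow> inj_on (s a) T" "\<And>r. r \<in> T \<Longrightarrow> inj_on (\<lambda>a. s a r) E"
    and large: "real (card T) * q \<ge> 32" "real (card E) * real (card T) * q\<^sup>2 \<ge> 16"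
    and schur: "\<And>a r. a \<in> E \<Longrightarrow> r \<in> T \<Longrightarrow> schur (A \<union> {r, s a r})"
  shows "measure_pmf.prob (random_subset n q) {R. schur (A \<union> R)} \<ge> 1 / 2"
proof -
  define Fam where "Fam = (\<lambda>(a, r). {r, s a r}) ` (E \<times> T)"
  have finFam: "finite Fam" unfolding Fam_def using fin by simp
  have Fam: "F \<subseteq> {1..n} \<and> card F = 2" if "F \<in> Fam" for F
    using that rs by (auto simp: Fam_def card_insert_if)
  \<comment> \<open>A pair with its element \<open>r\<close> marked determines \<open>s a r\<close>
    and, by injectivity, \<open>a\<close>. As a pair has two elements to mark,
    \<open>card E * card T\<close> is at most \<open>2 * card Fam\<close>.\<close>
  have "card (E \<times> T) \<le> card (SIGMA F:Fam. F)"
  proof (rule card_inj_on_le)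
    show "inj_on (\<lambda>(a, r). ({r, s a r}, r)) (E \<times> T)"
    proof (rule inj_onI)
      fix w w' assume w: "w \<in> E \<times> T" "w' \<in> E \<times> T"
        "(case w of (a, r) \<Rightarrow> ({r, s a r}, r)) = (case w' of (a, r) \<Rightarrow> ({r, s a r}, r))"
      obtain a r a' r' where eq: "w = (a, r)" "w' = (a', r')" by (cases w, cases w') auto
      hence "a \<in> E" "r \<in> T" "a' \<in> E" "r' = r" "s a r = s a' r"
        using w by (auto simp: doubleton_eq_iff)
      moreover from this have "a = a'" using inj(2)[of r] by (auto dest: inj_onD)
      ultimately show "w = w'" by (simp add: eq)
    qed
    show "(\<lambda>(a, r). ({r, s a r}, r)) ` (E \<times> T) \<subseteq> (SIGMA F:Fam. F)"
      by (auto simp: Fam_def)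
    show "finite (SIGMA F:Fam. F)"
      using finFam Fam finite_subset by (intro finite_SigmaI) blast+
  qed
  also have "\<dots> = (\<Sum>F\<in>Fam. card F)"
    using finFam Fam finite_subset[of _ "{1..n}"] by (subst card_SigmaI) auto
  also have "\<dots> = 2 * card Fam" using Fam by simp
  finally have "real (card (E \<times> T)) \<le> real (2 * card Fam)" by (rule of_nat_mono)
  hence Fam_ge: "real (card E) * real (card T) / 2 \<le> real (card Fam)"
    by (simp add: card_cartesian_product)
  have Fam0: "Fam \<noteq> {}"
  proof
    assume "Fam = {}"
    hence "real (card E) * real (card T) * q\<^sup>2 \<le> 0"
      using Fam_ge q by (auto simp: mult_le_0_iff)
    thus False using large(2) by linarith
  qed
  have "1 - 2 ^ 2 * (1 / 8) \<le> measure_pmf.prob (random_subset n q) {R. \<exists>F\<in>Fam. F \<subseteq> R}"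
  proof (rule spread_family_hit[OF q _ Fam0 Fam])
    fix S :: "nat set"
    assume S: "S \<noteq> {}" "S \<subseteq> {1..n}" "card S \<le> 2"
    have finS: "finite S" using S finite_subset by blast
    hence "card S = 1 \<or> card S = 2" using S by (metis card_0_eq le_Suc_eq le_zero_eq numeral_2_eq_2 One_nat_def)
    thus "real (card {F \<in> Fam. S \<subseteq> F}) \<le> 1 / 8 * real (card Fam) * q ^ card S"
    proof
      assume "card S = 1"
      then obtain v where v: "S = {v}" by (auto simp: card_1_singleton_iff)
      have "{F \<in> Fam. S \<subseteq> F} \<subseteq> (\<lambda>a. {v, s a v}) ` E \<union> (\<Union>a\<in>E. (\<lambda>r. {r, s a r}) ` {r \<in> T. s a r = v})"
        by (auto simp: v Fam_def)
      hence "card {F \<in> Fam. S \<subseteq> F} \<le> card ((\<lambda>a. {v, s a v}) ` E \<union> (\<Union>a\<in>E. (\<lambda>r. {r, s a r}) ` {r \<in> T. s a r = v}))"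
        by (rule card_mono[rotated]) (use fin in auto)
      also have "\<dots> \<le> card ((\<lambda>a. {v, s a v}) ` E) + card (\<Union>a\<in>E. (\<lambda>r. {r, s a r}) ` {r \<in> T. s a r = v})"
        by (rule card_Un_le)
      also have "\<dots> \<le> card E + (\<Sum>a\<in>E. 1)"
      proof (rule add_mono)
        show "card ((\<lambda>a. {v, s a v}) ` E) \<le> card E" by (rule card_image_le[OF fin(1)])
        have "card (\<Union>a\<in>E. (\<lambda>r. {r, s a r}) ` {r \<in> T. s a r = v}) \<le>
            (\<Sum>a\<in>E. card ((\<lambda>r. {r, s a r}) ` {r \<in> T. s a r = v}))"
          by (rule card_UN_le[OF fin(1)])
        also have "\<dots> \<le> (\<Sum>a\<in>E. 1)"
        proof (rule sum_mono)
          fix a assume a: "a \<in> E"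
          have "card ((\<lambda>r. {r, s a r}) ` {r \<in> T. s a r = v}) \<le> card {r \<in> T. s a r = v}"
            by (rule card_image_le) (use fin in auto)
          also have "\<dots> \<le> 1"
            using inj(1)[OF a] by (subst card_le_Suc0_iff_eq[folded One_nat_def]) (use fin in \<open>auto dest: inj_onD\<close>)
          finally show "card ((\<lambda>r. {r, s a r}) ` {r \<in> T. s a r = v}) \<le> 1" .
        qed
        finally show "card (\<Union>a\<in>E. (\<lambda>r. {r, s a r}) ` {r \<in> T. s a r = v}) \<le> (\<Sum>a\<in>E. 1)" .
      qed
      also have "\<dots> = 2 * card E" by simp
      finally have "real (card {F \<in> Fam. S \<subseteq> F}) \<le> real (2 * card E)" by (rule of_nat_mono)
      also have "\<dots> = 1 / 16 * real (card E) * 32" by simp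
      also have "\<dots> \<le> 1 / 16 * real (card E) * (real (card T) * q)"
        by (intro mult_left_mono large) auto
      also have "\<dots> = 1 / 8 * (real (card E) * real (card T) / 2) * q ^ card S" by (simp add: v)
      also have "\<dots> \<le> 1 / 8 * real (card Fam) * q ^ card S"
        by (intro mult_right_mono mult_left_mono Fam_ge) (use q in auto)
      finally show ?thesis .
    next
      assume cS: "card S = 2"
      have "{F \<in> Fam. S \<subseteq> F} \<subseteq> {S}"
        using Fam cS card_subset_eq finite_subset by (metis (mono_tags, lifting) finite_atLeastAtMost insertI1 mem_Collect_eq subsetI)
      hence "card {F \<in> Fam. S \<subseteq> F} \<le> 1"
        using card_mono[of "{S}"] by fastforce
      hence "real (card {F \<in> Fam. S \<subseteq> F}) \<le> 1 / 16 * 16" by simp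
      also have "\<dots> \<le> 1 / 16 * (real (card E) * real (card T) * q\<^sup>2)"
        by (intro mult_left_mono large) auto
      also have "\<dots> = 1 / 8 * (real (card E) * real (card T) / 2) * q ^ card S" by (simp add: cS)
      also have "\<dots> \<le> 1 / 8 * real (card Fam) * q ^ card S"
        by (intro mult_right_mono mult_left_mono Fam_ge) (use q in auto)
      finally show ?thesis .
    qed
  qed simp
  also have "\<dots> \<le> measure_pmf.prob (random_subset n q) {R. schur (A \<union> R)}"
  proof (rule measure_pmf.finite_measure_mono)
    have "schur (A \<union> F)" if "F \<in> Fam" for F using that schur by (auto simp: Fam_def)
    thus "{R. \<exists>F\<in>Fam. F \<subseteq> R} \<subseteq> {R. schur (A \<union> R)}"
      using schur_mono by blast
  qed simp
  finally show ?thesis by simp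
qed

text \<open>Union bound. It serves to find a base point whose seven translates in
  \<open>schur_prism\<close> all lie in \<open>A\<close>.\<close>

lemma ex_avoiding_exceptions:
  assumes "finite J" "finite D" and "\<And>d. d \<in> D \<Longrightarrow> card {j \<in> J. \<not> P j d} \<le> b"
    and "card D * b < card J"
  shows "\<exists>j\<in>J. \<forall>d\<in>D. P j d"
proof (rule ccontr)
  assume "\<not> ?thesis"
  hence "J \<subseteq> (\<Union>d\<in>D. {j \<in> J. \<not> P j d})" by auto
  hence "card J \<le> card (\<Union>d\<in>D. {j \<in> J. \<not> P j d})"
    by (rule card_mono[rotated]) (use assms in auto)
  also have "\<dots> \<le> (\<Sum>d\<in>D. card {j \<in> J. \<not> P j d})" by (rule card_UN_le) fact
  also have "\<dots> \<le> (\<Sum>d\<in>D. b)" by (intro sum_mono assms)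
  finally show False using assms by simp
qed

lemma card_seven_elements_le: "card {a1, a2, a3, a4, a5, a6, a7} \<le> 7"
  using card_length[of "[a1, a2, a3, a4, a5, a6, a7]"] by simp

text \<open>With at least \<open>n / 2\<close> elements but few even ones, \<open>A\<close> misses
  few odd numbers. For even \<open>a\<close> and even \<open>r\<close> all translates of an odd base
  point are odd, so some base point completes \<open>schur_prism\<close> inside
  \<open>A\<close>.\<close>

lemma mostly_odd_hit:
  fixes q :: real
  assumes q: "0 < q" "q \<le> 1" and n: "n \<ge> 1000"
    and A: "A \<subseteq> {1..n}" "n \<le> 2 * card A" and few: "50 * card {a \<in> A. even a} \<le> n"
    and nq: "real n * q \<ge> 1024"
    and evens: "real (card {a \<in> A. even a}) * real n * q\<^sup>2 \<ge> 1024"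
  shows "measure_pmf.prob (random_subset n q) {R. schur (A \<union> R)} \<ge> 1 / 2"
proof -
  define E where "E = {a \<in> A. even a}"
  define T where "T = (\<lambda>j. 2 * j) ` {1..n div 16}"
  \<comment> \<open>Keep the half of \<open>[n]\<close> that holds at least half of the even
    elements; \<open>r\<close> is added to small \<open>a\<close> and subtracted from large
    \<open>a\<close>, so \<open>s a r\<close> stays in \<open>[n]\<close>.\<close>
  define low where "low \<longleftrightarrow> card E \<le> 2 * card {a \<in> E. 2 * a \<le> n}"
  define E' where "E' = {a \<in> E. 2 * a \<le> n \<longleftrightarrow> low}"
  define s where "s a r = (if low then a + r else a - r)" for a r :: nat
  have finA: "finite A" using A finite_subset by blast
  hence finE: "finite E" "finite E'" by (simp_all add: E_def E'_def)
  have E': "card E \<le> 2 * card E'"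
  proof (cases low)
    case False
    have "E = {a \<in> E. 2 * a \<le> n} \<union> E'" using False by (auto simp: E'_def)
    from arg_cong[where f = card, OF this] have "card E \<le> card {a \<in> E. 2 * a \<le> n} + card E'"
      using card_Un_le[of "{a \<in> E. 2 * a \<le> n}" E'] by linarith
    thus ?thesis using False by (simp add: low_def)
  qed (simp add: E'_def low_def)
  have T: "even r \<and> 2 \<le> r \<and> 8 * r \<le> n" if "r \<in> T" for r using that by (auto simp: T_def)
  have cT: "card T = n div 16" unfolding T_def by (subst card_image) (auto simp: inj_on_def)
  have cT_ge: "real (card T) \<ge> real n / 32" unfolding cT using n by linarith
  define Mo where "Mo = {x \<in> {1..n}. odd x} - A"
  have Mo: "50 * card Mo \<le> n + 25"
  proof -
    have "{x \<in> {1..n}. odd x} \<subseteq> (\<lambda>j. 2 * j + 1) ` {..<(n + 1) div 2}"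
    proof
      fix x assume x: "x \<in> {x \<in> {1..n}. odd x}"
      then obtain j where "x = 2 * j + 1" by (auto elim: oddE)
      thus "x \<in> (\<lambda>j. 2 * j + 1) ` {..<(n + 1) div 2}" using x by auto
    qed
    from card_mono[OF _ this] have "card {x \<in> {1..n}. odd x} \<le> (n + 1) div 2"
      using card_image_le[of "{..<(n + 1) div 2}" "\<lambda>j. 2 * j + 1"] by simp
    moreover have "A = E \<union> (A \<inter> {x \<in> {1..n}. odd x})" using A by (auto simp: E_def)
    from arg_cong[where f = card, OF this]
    have "card A \<le> card E + card (A \<inter> {x \<in> {1..n}. odd x})"
      using card_Un_le[of E "A \<inter> {x \<in> {1..n}. odd x}"] by linarith
    moreover have "card (Mo \<union> (A \<inter> {x \<in> {1..n}. odd x})) = card Mo + card (A \<inter> {x \<in> {1..n}. odd x})"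
      by (rule card_Un_disjoint) (auto simp: Mo_def finA)
    moreover have "Mo \<union> (A \<inter> {x \<in> {1..n}. odd x}) = {x \<in> {1..n}. odd x}"
      by (auto simp: Mo_def)
    ultimately show ?thesis using A(2) few by (simp add: E_def)
  qed
  show ?thesis
  proof (rule pair_family_hit[OF q finE(2)])
    show "finite T" by (simp add: T_def)
  next
    fix a r assume ar: "a \<in> E'" "r \<in> T"
    have a: "1 \<le> a" "a \<le> n" "even a" and low: "2 * a \<le> n \<longleftrightarrow> low"
      using ar A by (auto simp: E_def E'_def)
    note r = T[OF ar(2)]
    show "{r, s a r} \<subseteq> {1..n} \<and> r \<noteq> s a r"
      using a r n low by (auto simp: s_def)
    define \<rho> where "\<rho> = (if low then int r else - int r)"
    define D where "D = {0, \<rho>, 2 * \<rho>, int a, int a + \<rho>, int a + 2 * \<rho>, int a + 3 * \<rho>}"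
    have \<rho>: "even \<rho>" "8 * \<rho> \<le> int n" "- int n \<le> 8 * \<rho>"
        "2 * int a \<le> int n \<and> 0 \<le> \<rho> \<or> int n < 2 * int a \<and> \<rho> \<le> 0"
      subgoal using r unfolding \<rho>_def by simp
      subgoal using r unfolding \<rho>_def by simp
      subgoal using r unfolding \<rho>_def by simp
      using low unfolding \<rho>_def by (cases low) auto
    have D: "even d \<and> 4 * d \<ge> - int n \<and> d \<le> int n" if "d \<in> D" for d
    proof (intro conjI)
      have d: "d = 0 \<or> d = \<rho> \<or> d = 2 * \<rho> \<or> d = int a \<or> d = int a + \<rho> \<or> d = int a + 2 * \<rho> \<or> d = int a + 3 * \<rho>"
        using that by (simp add: D_def)
      show "even d" using d a(3) \<rho>(1) by (elim disjE) simp_all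
      show "4 * d \<ge> - int n" "d \<le> int n" using d \<rho>(2-) a(1,2) by (elim disjE; linarith)+
    qed
    have fin7: "finite D" "card D \<le> 7" unfolding D_def by (simp, rule card_seven_elements_le)
    \<comment> \<open>The base points \<open>- (2 j + 1)\<close> are odd and of size at most about
      \<open>3 n / 4\<close>. Translates \<open>d\<close> between \<open>- n / 4\<close> and
      \<open>n\<close> then keep the absolute value at most \<open>n\<close>.\<close>
    define J where "J = {..<3 * n div 8}"
    have "\<exists>j\<in>J. \<forall>d\<in>D. nat \<bar>- (2 * int j + 1) + d\<bar> \<in> A"
    proof (rule ex_avoiding_exceptions)
      fix d assume d: "d \<in> D"
      \<comment> \<open>A bad translate is plus or minus an element of \<open>Mo\<close>, so each
        \<open>d\<close> excludes at most \<open>2 * card Mo\<close> base points. Seven of them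
        exclude about \<open>14 n / 50\<close>, less than \<open>3 n / 8\<close>.\<close>
      have "{j \<in> J. nat \<bar>- (2 * int j + 1) + d\<bar> \<notin> A} \<subseteq>
          {j \<in> J. - (2 * int j + 1) + d \<in> int ` Mo \<union> (\<lambda>x. - int x) ` Mo}"
      proof safe
        fix j assume j: "j \<in> J" "nat \<bar>- (2 * int j + 1) + d\<bar> \<notin> A" "- (2 * int j + 1) + d \<notin> (\<lambda>x. - int x) ` Mo"
        define y where "y = - (2 * int j + 1) + d"
        have "8 * int j < 3 * int n" using j(1) unfolding J_def lessThan_iff by linarith
        hence y: "odd y" "\<bar>y\<bar> \<le> int n" using D[OF d] unfolding y_def by (simp, linarith)
        hence "y \<noteq> 0" by auto
        hence Mo: "nat \<bar>y\<bar> \<in> Mo" using y j(2) unfolding y_def[symmetric] Mo_def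
          by (simp add: even_nat_iff nat_le_iff Suc_le_eq)
        have "y = int (nat \<bar>y\<bar>) \<or> y = - int (nat \<bar>y\<bar>)" by linarith
        hence "y \<in> int ` Mo \<union> (\<lambda>x. - int x) ` Mo" using Mo by blast
        thus "- (2 * int j + 1) + d \<in> int ` Mo" using j(3) by (auto simp: y_def)
      qed
      hence "card {j \<in> J. nat \<bar>- (2 * int j + 1) + d\<bar> \<notin> A} \<le>
          card {j \<in> J. - (2 * int j + 1) + d \<in> int ` Mo \<union> (\<lambda>x. - int x) ` Mo}"
        by (rule card_mono[rotated]) (simp add: J_def)
      also have "\<dots> \<le> card (int ` Mo \<union> (\<lambda>x. - int x) ` Mo)"
        by (rule card_inj_on_le[where f = "\<lambda>j. - (2 * int j + 1) + d"]) (auto simp: inj_on_def Mo_def)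
      also have "\<dots> \<le> card (int ` Mo) + card ((\<lambda>x. - int x) ` Mo)" by (rule card_Un_le)
      also have "\<dots> \<le> 2 * card Mo"
        using card_image_le[of Mo int] card_image_le[of Mo "\<lambda>x. - int x"] by (simp add: Mo_def)
      finally show "card {j \<in> J. nat \<bar>- (2 * int j + 1) + d\<bar> \<notin> A} \<le> 2 * card Mo" .
    next
      have "card D * (2 * card Mo) \<le> 7 * (2 * card Mo)" using fin7 by (intro mult_right_mono) auto
      also have "\<dots> < 3 * n div 8" using Mo n by linarith
      finally show "card D * (2 * card Mo) < card J" by (simp add: J_def)
    qed (use fin7 in \<open>auto simp: J_def\<close>)
    then obtain j where j: "\<forall>d\<in>D. nat \<bar>- (2 * int j + 1) + d\<bar> \<in> A" by blast
    show "schur (A \<union> {r, s a r})"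
    proof (rule schur_prism[where a = "int a" and r = \<rho> and x = "- (2 * int j + 1)"])
      show "nat \<bar>int a\<bar> \<in> A \<union> {r, s a r}" using ar by (simp add: E_def E'_def)
      show "nat \<bar>\<rho>\<bar> \<in> A \<union> {r, s a r}" by (simp add: \<rho>_def)
      have "nat \<bar>int a + \<rho>\<bar> = s a r" using r low by (auto simp: s_def \<rho>_def)
      thus "nat \<bar>int a + \<rho>\<bar> \<in> A \<union> {r, s a r}" by simp
      fix d assume "d \<in> {0, \<rho>, 2 * \<rho>, int a, int a + \<rho>, int a + 2 * \<rho>, int a + 3 * \<rho>}"
      thus "nat \<bar>- (2 * int j + 1) + d\<bar> \<in> A \<union> {r, s a r}" using j unfolding D_def by blast
    qed
  next
    fix a assume a: "a \<in> E'"
    show "inj_on (s a) T"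
    proof (rule inj_onI)
      fix r r' assume "r \<in> T" "r' \<in> T" "s a r = s a r'"
      thus "r = r'" using T[of r] T[of r'] a by (auto simp: s_def E'_def split: if_splits)
    qed
  next
    fix r assume "r \<in> T"
    thus "inj_on (\<lambda>a. s a r) E'"
      using T[of r] by (auto simp: inj_on_def s_def E'_def)
  next
    have "32 \<le> real n / 32 * q" using nq by simp
    also have "\<dots> \<le> real (card T) * q" using cT_ge q by (intro mult_right_mono) auto
    finally show "32 \<le> real (card T) * q" .
    have "16 \<le> real (card E) / 2 * (real n / 32) * q\<^sup>2" using evens by (simp add: E_def)
    also have "\<dots> \<le> real (card E') * real (card T) * q\<^sup>2"
      using cT_ge of_nat_mono[OF E', where ?'a = real] by (intro mult_right_mono mult_mono) auto
    finally show "16 \<le> real (card E') * real (card T) * q\<^sup>2" .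
  qed
qed

text \<open>Translates of a base point in \<open>[N, n - a - 3 r]\<close> stay in
  \<open>[N, n]\<close>, where only \<open>m\<close> elements are missing. Seven translates exclude
  at most \<open>7 m\<close> base points, fewer than there are.\<close>

lemma far_below_half_hit:
  fixes q :: real and n :: nat
  defines "N \<equiv> (n + 1) div 2"
  assumes q: "0 < q" "q \<le> 1" and A: "A \<subseteq> {1..n}" and m: "m = card ({N..n} - A)" "m \<ge> 1"
    and mq: "real m * q \<ge> 32" and far: "m \<le> 8 * card {a \<in> A. a + 20 * m \<le> N}"
  shows "measure_pmf.prob (random_subset n q) {R. schur (A \<union> R)} \<ge> 1 / 2"
proof -
  define E where "E = {a \<in> A. a + 20 * m \<le> N}"
  have finA: "finite A" using A finite_subset by blast
  hence finE: "finite E" by (simp add: E_def)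
  have N: "2 * N \<le> n + 1" "n \<le> 2 * N" unfolding N_def by linarith+
  show ?thesis
  proof (rule pair_family_hit[where s = "\<lambda>a r. a + r" and T = "{1..3 * m}", OF q finE])
    fix a r assume ar: "a \<in> E" "r \<in> {1..3 * m}"
    have a: "a \<ge> 1" "a + 20 * m \<le> N" "a \<in> A" using ar A by (auto simp: E_def)
    show "{r, a + r} \<subseteq> {1..n} \<and> r \<noteq> a + r" using a ar N by auto
    define D where "D = {0, r, 2 * r, a, a + r, a + 2 * r, a + 3 * r}"
    have fin7: "finite D" "card D \<le> 7" unfolding D_def by (simp, rule card_seven_elements_le)
    have "\<exists>x\<in>{N..n - a - 3 * r}. \<forall>d\<in>D. x + d \<in> A"
    proof (rule ex_avoiding_exceptions)
      fix d assume "d \<in> D"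
      hence d: "d \<le> a + 3 * r" by (auto simp: D_def)
      show "card {x \<in> {N..n - a - 3 * r}. x + d \<notin> A} \<le> m"
        unfolding m by (rule card_inj_on_le[where f = "\<lambda>x. x + d"]) (use d a ar N m in auto)
    next
      have "card D * m \<le> 7 * m" using fin7 by simp
      \<comment> \<open>\<open>a + 20 m \<le> N\<close>, \<open>r \<le> 3 m\<close> and
        \<open>2 N \<le> n + 1\<close> leave at least \<open>11 m\<close> points.\<close>
      also have "\<dots> < card {N..n - a - 3 * r}"
        using a ar N m(2) unfolding card_atLeastAtMost atLeastAtMost_iff by arith
      finally show "card D * m < card {N..n - a - 3 * r}" .
    qed (use fin7 in auto)
    then obtain x where x: "\<forall>d\<in>D. x + d \<in> A" by blast
    have x': "nat \<bar>int x + d\<bar> \<in> A \<union> {r, a + r}" if d: "d \<in> int ` D" for d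
    proof -
      obtain e where "d = int e" "e \<in> D" using d by blast
      moreover have "nat \<bar>int x + int e\<bar> = x + e" by simp
      ultimately show ?thesis using x by auto
    qed
    show "schur (A \<union> {r, a + r})"
    proof (rule schur_prism[where a = "int a" and r = "int r" and x = "int x"])
      have "nat \<bar>int a + int r\<bar> = a + r" by simp
      thus "nat \<bar>int a\<bar> \<in> A \<union> {r, a + r}" "nat \<bar>int r\<bar> \<in> A \<union> {r, a + r}" "nat \<bar>int a + int r\<bar> \<in> A \<union> {r, a + r}"
        using a by simp_all
      fix d assume "d \<in> {0, int r, 2 * int r, int a, int a + int r, int a + 2 * int r, int a + 3 * int r}"
      thus "nat \<bar>int x + d\<bar> \<in> A \<union> {r, a + r}" by (intro x') (simp add: D_def)
    qed
  next
    have "32 \<le> 3 * (real m * q)" using mq by linarith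
    thus "32 \<le> real (card {1..3 * m}) * q" by simp
    have "16 \<le> 3 / 8 * (32 * 32 :: real)" by simp
    also have "\<dots> \<le> 3 / 8 * ((real m * q) * (real m * q))"
      using mq by (intro mult_left_mono mult_mono) auto
    also have "\<dots> = (real m / 8) * real (card {1..3 * m}) * q\<^sup>2" by (simp add: power2_eq_square)
    also have "\<dots> \<le> real (card E) * real (card {1..3 * m}) * q\<^sup>2"
    proof (intro mult_right_mono)
      have "real m \<le> real (8 * card E)" unfolding E_def by (rule of_nat_mono[OF far])
      thus "real m / 8 \<le> real (card E)" by simp
    qed auto
    finally show "16 \<le> real (card E) * real (card {1..3 * m}) * q\<^sup>2" .
  qed (auto simp: inj_on_def)
qed

text \<open>A pair with \<open>a + b \<le> n - g\<close> gives a triangle \<open>x\<close>,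
  \<open>x + a\<close>, \<open>x + a + b\<close> for every \<open>x < g\<close>. At least
  \<open>g n\<close> such pairs yield \<open>g^2 n\<close> triangles, hence density
  \<open>\<gamma>^2\<close> in \<open>{..<n}\<close>.\<close>

lemma many_schur_pairs_hit:
  fixes q \<gamma> :: real
  assumes q: "0 < q" "q \<le> 1" and A: "A \<subseteq> {1..n}"
    and pairs: "2 * g * n \<le> card {(a, b) \<in> A \<times> A. a + b \<in> A}"
    and \<gamma>: "\<gamma> > 0" "\<gamma> * real n \<le> real g" "real n * q \<ge> 6912 / \<gamma> ^ 16" and "g \<le> n"
  shows "measure_pmf.prob (random_subset n q) {R. schur (A \<union> R)} \<ge> 1 / 2"
proof -
  define P where "P = {(a, b) \<in> A \<times> A. a + b \<in> A}"
  define P' where "P' = {(a, b) \<in> P. a + b + g \<le> n}"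
  have finA: "finite A" using A finite_subset by blast
  have finP: "finite P" unfolding P_def by (rule finite_subset[of _ "A \<times> A"]) (use finA in auto)
  \<comment> \<open>Pairs with sum above \<open>n - g\<close> are determined by \<open>a\<close> and
    \<open>a + b\<close>; they use up at most half of the bound in \<open>pairs\<close>.\<close>
  have "card (P - P') \<le> card ({1..n} \<times> {n - g<..n})"
  proof (rule card_inj_on_le)
    show "inj_on (\<lambda>(a, b). (a, a + b)) (P - P')" by (auto simp: inj_on_def)
    show "(\<lambda>(a, b). (a, a + b)) ` (P - P') \<subseteq> {1..n} \<times> {n - g<..n}"
    proof safe
      fix a b assume "(a, b) \<in> P" "(a, b) \<notin> P'"
      moreover from this have "a \<in> {1..n}" "a + b \<in> {1..n}" using A by (auto simp: P_def)
      ultimately show "a \<in> {1..n}" "a + b \<in> {n - g<..n}" using \<open>g \<le> n\<close> by (auto simp: P'_def)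
    qed
  qed simp
  also have "\<dots> = n * g" using \<open>g \<le> n\<close> by (simp add: card_cartesian_product)
  finally have "card (P - P') \<le> n * g" .
  moreover have "card P = card P' + card (P - P')"
  proof -
    have "P' \<subseteq> P" by (auto simp: P'_def)
    thus ?thesis using finP card_Diff_subset[of P' P] card_mono[of P P'] finite_subset[of P' P] by simp
  qed
  ultimately have P': "g * n \<le> card P'" using pairs by (simp add: P_def mult_ac)
  define T where "T = (\<lambda>((a, b), x). (x, x + a, x + a + b)) ` (P' \<times> {..<g})"
  have "card T = card P' * g"
    unfolding T_def by (subst card_image) (auto simp: inj_on_def card_cartesian_product)
  hence cT: "g * n * g \<le> card T" using P' by simp
  show ?thesis
  proof (rule dense_triangles_hit[OF q, where ?p1.0 = 0 and ?p2.0 = 0 and V = n and T = T and \<tau> = "\<gamma>\<^sup>2"])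
    show "T \<subseteq> {..<n} \<times> {..<n} \<times> {..<n}"
      using A by (fastforce simp: T_def P_def P'_def)
    have "\<gamma>\<^sup>2 * real n ^ 3 = (\<gamma> * real n) * real n * (\<gamma> * real n)"
      by (simp add: power2_eq_square power3_eq_cube)
    also have "\<dots> \<le> real g * real n * real g"
      using \<gamma> by (intro mult_mono) auto
    also have "\<dots> \<le> real (card T)" using of_nat_mono[OF cT, where ?'a = real] by simp
    finally show "\<gamma>\<^sup>2 * real n ^ 3 \<le> real (card T)" .
    show "6912 / (\<gamma>\<^sup>2) ^ 8 \<le> real n * q" using \<gamma>(3) by (simp flip: power_mult)
    fix x y z assume "(x, y, z) \<in> T"
    then obtain a b where "y = x + a" "z = x + a + b" "a \<in> A" "b \<in> A" "a + b \<in> A"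
      by (auto simp: T_def P_def P'_def)
    moreover from this have "nat \<bar>0 + 0 + int z - int x\<bar> = a + b" by simp
    ultimately show "nat \<bar>0 + int y - int x\<bar> \<in> A \<and> nat \<bar>0 + int z - int y\<bar> \<in> A \<and> nat \<bar>0 + 0 + int z - int x\<bar> \<in> A"
      by simp
  qed (use \<gamma> in auto)
qed

text \<open>For \<open>a\<close> just below \<open>N\<close>, counting the pairs \<open>(x, x + a)\<close> with \<open>x\<close> near \<open>N\<close> and \<open>x + a\<close> near \<open>n\<close> gives
  at least \<open>m / 8\<close> pairs inside \<open>A\<close>: the at least \<open>7 m / 8\<close> elements near \<open>N\<close> almost compensate the
  \<open>m\<close> missing ones.\<close>

lemma near_half_hit:
  fixes q :: real and n :: nat
  defines "N \<equiv> (n + 1) div 2"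
  assumes q: "0 < q" "q \<le> 1" and A: "A \<subseteq> {1..n}" and m: "m = card ({N..n} - A)" "m \<ge> 1" "200 * m \<le> n"
    and mq: "100 * (real m * q) \<ge> 6912 * 10 ^ 48"
    and near: "7 * m \<le> 8 * card {a \<in> A. N < a + 20 * m \<and> a < N}"
  shows "measure_pmf.prob (random_subset n q) {R. schur (A \<union> R)} \<ge> 1 / 2"
proof -
  define L where "L = {a \<in> A. N < a + 20 * m \<and> a < N}"
  \<comment> \<open>The gap of more than \<open>m / 4\<close> between \<open>a\<close> and
    \<open>N\<close> lengthens the range \<open>I\<close> of \<open>x\<close> by as much, while at
    most \<open>m div 4\<close> elements are discarded.\<close>
  define L' where "L' = {a \<in> L. a + m div 4 < N}"
  define X where "X a = {x \<in> A. N < x + 20 * m \<and> x + a \<in> A}" for a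
  have finA: "finite A" using A finite_subset by blast
  hence finL: "finite L" "finite L'" and finX: "finite (X a)" for a by (simp_all add: L_def L'_def X_def)
  have N: "2 * N \<le> n + 1" "n \<le> 2 * N" unfolding N_def by linarith+
  have cL': "m \<le> 2 * card L'"
  proof -
    have "L - L' \<subseteq> {N - m div 4..<N}" by (auto simp: L_def L'_def)
    hence "card (L - L') \<le> card {N - m div 4..<N}" by (rule card_mono[rotated]) simp
    hence "card (L - L') \<le> m div 4" by simp
    moreover have "card L \<le> card L' + card (L - L')"
      using finL card_Un_le[of L' "L - L'"] card_mono[of "L' \<union> (L - L')" L] by fastforce
    ultimately show ?thesis using near by (simp add: L_def)
  qed
  have cX: "m \<le> 8 * card (X a)" if a: "a \<in> L'" for a
  proof -
    have a': "N < a + 20 * m" "a + m div 4 < N" "a < N" using a by (auto simp: L'_def L_def)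
    have "a \<le> n" using a A by (auto simp: L'_def L_def)
    define I where "I = {N - 20 * m<..n - a}"
    have I20: "20 * m \<le> N" using N m by linarith
    have "card I \<le> card (X a) + card (I - A) + card ({N - 20 * m + a<..n} - A)"
    proof -
      have "I \<subseteq> X a \<union> ((I - A) \<union> {x \<in> I. x + a \<notin> A})"
        using I20 by (auto simp: I_def X_def)
      hence "card I \<le> card (X a \<union> ((I - A) \<union> {x \<in> I. x + a \<notin> A}))"
        by (rule card_mono[rotated]) (use finX in \<open>auto simp: I_def\<close>)
      also have "\<dots> \<le> card (X a) + (card (I - A) + card {x \<in> I. x + a \<notin> A})"
        by (intro order_trans[OF card_Un_le] add_mono card_Un_le order_refl)
      also have "card {x \<in> I. x + a \<notin> A} \<le> card ({N - 20 * m + a<..n} - A)"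
        by (rule card_inj_on_le[where f = "\<lambda>x. x + a"]) (use \<open>a \<le> n\<close> in \<open>auto simp: I_def\<close>)
      finally show ?thesis by simp
    qed
    moreover have "card (I - A) + card L \<le> card {N - 20 * m<..<N} + card ({N..n - a} - A)"
    proof -
      have "I - A \<subseteq> ({N - 20 * m<..<N} - L) \<union> ({N..n - a} - A)"
        using I20 by (auto simp: I_def L_def)
      hence "card (I - A) \<le> card (({N - 20 * m<..<N} - L) \<union> ({N..n - a} - A))"
        by (rule card_mono[rotated]) simp
      also have "\<dots> \<le> card ({N - 20 * m<..<N} - L) + card ({N..n - a} - A)" by (rule card_Un_le)
      also have "card ({N - 20 * m<..<N} - L) = card {N - 20 * m<..<N} - card L"
        by (rule card_Diff_subset) (use finL I20 in \<open>auto simp: L_def\<close>)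
      finally have "card (I - A) \<le> card {N - 20 * m<..<N} - card L + card ({N..n - a} - A)" .
      moreover have "card L \<le> card {N - 20 * m<..<N}"
        by (rule card_mono) (use I20 in \<open>auto simp: L_def\<close>)
      ultimately show ?thesis by linarith
    qed
    \<comment> \<open>As \<open>200 m \<le> n\<close>, the two ranges are disjoint, so no element
      missing from \<open>[N, n]\<close> is counted twice.\<close>
    moreover have "card ({N..n - a} - A) + card ({N - 20 * m + a<..n} - A) \<le> m"
    proof -
      have "card ({N..n - a} - A) + card ({N - 20 * m + a<..n} - A) =
          card (({N..n - a} - A) \<union> ({N - 20 * m + a<..n} - A))"
        by (rule card_Un_disjoint[symmetric]) (use a' N m I20 in auto)
      also have "\<dots> \<le> m" unfolding m(1)
        by (rule card_mono) (use a' N m I20 in auto)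
      finally show ?thesis .
    qed
    moreover have "card I = n - a - (N - 20 * m)" "card {N - 20 * m<..<N} = 20 * m - 1"
      using I20 m by (simp_all add: I_def)
    \<comment> \<open>By \<open>2 N \<le> n + 1\<close>, the gap of \<open>m / 4\<close> and
      \<open>card L \<ge> 7 m / 8\<close> against the loss \<open>m\<close> leave
      \<open>m / 8\<close> for \<open>X a\<close>.\<close>
    ultimately have "n - a - (N - 20 * m) + card L \<le> card (X a) + (20 * m - 1) + m" by linarith
    thus ?thesis using near a' N I20 m(2) unfolding L_def by linarith
  qed
  \<comment> \<open>The offset \<open>N - 20 m\<close> is removed from \<open>a\<close> and
    \<open>x\<close> here and restored by \<open>p1\<close> and \<open>p2\<close>, so all parts fit
    into windows of length \<open>100 m\<close>. At least \<open>m^2 / 16\<close> pairs and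
    \<open>20 m\<close> starting points give at least \<open>m^3\<close> triangles, of density
    \<open>1 / 10^6\<close>.\<close>
  define T where "T = (\<lambda>((a, x), u). (u, u + (a - (N - 20 * m)), u + (a - (N - 20 * m)) + (x - (N - 20 * m)))) `
     ((SIGMA a:L'. X a) \<times> {..<20 * m})"
  have I20: "20 * m \<le> N" using N m by linarith
  have "card T = card ((SIGMA a:L'. X a) \<times> {..<20 * m})"
    unfolding T_def
  proof (rule card_image, rule inj_onI)
    fix w w' assume w: "w \<in> (SIGMA a:L'. X a) \<times> {..<20 * m}" "w' \<in> (SIGMA a:L'. X a) \<times> {..<20 * m}"
      "(\<lambda>((a, x), u). (u, u + (a - (N - 20 * m)), u + (a - (N - 20 * m)) + (x - (N - 20 * m)))) w =
       (\<lambda>((a, x), u). (u, u + (a - (N - 20 * m)), u + (a - (N - 20 * m)) + (x - (N - 20 * m)))) w'"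
    obtain a x u a' x' u' where eq: "w = ((a, x), u)" "w' = ((a', x'), u')" by (cases w, cases w') auto
    have "N < a + 20 * m" "N < a' + 20 * m" "N < x + 20 * m" "N < x' + 20 * m"
      using w(1,2) by (auto simp: eq L'_def L_def X_def)
    thus "w = w'" using w(3) I20 by (auto simp: eq)
  qed
  also have "\<dots> = (\<Sum>a\<in>L'. card (X a)) * (20 * m)"
    using finL finX by (simp add: card_cartesian_product)
  finally have cT: "card T = (\<Sum>a\<in>L'. card (X a)) * (20 * m)" .
  have "m * m \<le> 2 * card L' * m" using cL' by simp
  also have "\<dots> = 2 * (\<Sum>a\<in>L'. m)" by simp
  also have "\<dots> \<le> 2 * (\<Sum>a\<in>L'. 8 * card (X a))" by (intro mult_left_mono sum_mono cX) auto
  also have "\<dots> = 16 * (\<Sum>a\<in>L'. card (X a))" by (simp add: sum_distrib_left)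
  finally have "m * m \<le> (\<Sum>a\<in>L'. card (X a)) * 20" by linarith
  from mult_right_mono[OF this, of m] have "m ^ 3 \<le> card T"
    unfolding cT by (simp add: power3_eq_cube mult_ac)
  from of_nat_mono[OF this, where ?'a = real] have cT_ge: "real m ^ 3 \<le> real (card T)" by simp
  show ?thesis
  proof (rule dense_triangles_hit[OF q, where ?p1.0 = "int N - 20 * int m" and ?p2.0 = "int N - 20 * int m"
        and V = "100 * m" and T = T and \<tau> = "1 / 10 ^ 6"])
    show "T \<subseteq> {..<100 * m} \<times> {..<100 * m} \<times> {..<100 * m}"
    proof
      fix w assume "w \<in> T"
      then obtain a x u where w: "w = (u, u + (a - (N - 20 * m)), u + (a - (N - 20 * m)) + (x - (N - 20 * m)))"
          "a \<in> L'" "x \<in> X a" "u < 20 * m"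
        by (auto simp: T_def)
      have "x + a \<le> n" using w A by (auto simp: X_def)
      moreover have "N < a + 20 * m" "a < N" using w by (auto simp: L'_def L_def)
      ultimately have "a - (N - 20 * m) < 20 * m" "x - (N - 20 * m) \<le> 40 * m"
        using N I20 by linarith+
      thus "w \<in> {..<100 * m} \<times> {..<100 * m} \<times> {..<100 * m}" using w(1,4) by auto
    qed
    have "1 / 10 ^ 6 * real (100 * m) ^ 3 = real m ^ 3" by (simp add: power_mult_distrib)
    thus "1 / 10 ^ 6 * real (100 * m) ^ 3 \<le> real (card T)" using cT_ge by linarith
    show "6912 / (1 / 10 ^ 6) ^ 8 \<le> real (100 * m) * q" using mq by (simp add: power_one_over)
    fix x y z assume "(x, y, z) \<in> T"
    then obtain a b where w: "y = x + (a - (N - 20 * m))" "z = x + (a - (N - 20 * m)) + (b - (N - 20 * m))"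
        "a \<in> L'" "b \<in> X a"
      by (auto simp: T_def)
    have "N < a + 20 * m" "N < b + 20 * m" "a \<in> A" "b \<in> A" "b + a \<in> A"
      using w(3,4) by (auto simp: L'_def L_def X_def)
    moreover from this have "nat \<bar>int N - 20 * int m + int y - int x\<bar> = a"
        "nat \<bar>int N - 20 * int m + int z - int y\<bar> = b"
        "nat \<bar>int N - 20 * int m + (int N - 20 * int m) + int z - int x\<bar> = b + a"
      using w(1,2) I20 by linarith+
    ultimately show "nat \<bar>int N - 20 * int m + int y - int x\<bar> \<in> A \<and>
        nat \<bar>int N - 20 * int m + int z - int y\<bar> \<in> A \<and>
        nat \<bar>int N - 20 * int m + (int N - 20 * int m) + int z - int x\<bar> \<in> A" by simp
  qed (use m in auto)
qed

section \<open>Sets with few Schur triples\<close>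

text \<open>Sum-freeness up to \<open>h\<close> errors at every single element, for a set of at
  least about half its maximum \<open>M\<close>. Bounding the errors elementwise permits shifts by
  any chosen element and reflection in \<open>M\<close>.\<close>

locale almost_sum_free =
  fixes A :: "nat set" and h M :: nat
  assumes M: "M \<in> A" "\<And>a. a \<in> A \<Longrightarrow> 1 \<le> a \<and> a \<le> M"
    and h: "h \<ge> 1"
    and large: "M \<le> 2 * card A + h"
    and few_sums: "\<And>a. a \<in> A \<Longrightarrow> card {x \<in> A. x + a \<in> A} \<le> h"
    and few_diffs: "\<And>a. a \<in> A \<Longrightarrow> card {x \<in> A. x < a \<and> a - x \<in> A} \<le> h"
begin

section \<open>Reflection in the maximum and shifts by elements\<close>

lemma finA: "finite A"
  by (rule finite_subset[of _ "{1..M}"]) (use M(2) in auto)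

text \<open>The guiding rule is that \<open>A\<close> contains exactly one of \<open>x\<close>,
  \<open>M - x\<close>; these are its violations. \<open>shift_exc\<close> does the same for
  \<open>x\<close>, \<open>x + a\<close>.\<close>

definition reflect_exc :: "nat set" where
  "reflect_exc = {x \<in> {1..<M}. (x \<in> A) = (M - x \<in> A)}"

definition shift_exc :: "nat \<Rightarrow> nat set" where
  "shift_exc a = {x \<in> {1..<M - a}. (x \<in> A) = (x + a \<in> A)}"

lemma finite_exc [simp]: "finite reflect_exc" "finite (shift_exc a)"
  by (simp_all add: reflect_exc_def shift_exc_def)

text \<open>Both points in \<open>A\<close> form a Schur triple with \<open>M\<close>, so this is
  rare. Points with neither in \<open>A\<close> are missed by \<open>A\<close> and by its
  reflection, which hardly overlap; the size of \<open>A\<close> leaves at most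
  \<open>2 h + 1\<close> of them.\<close>

lemma card_reflect_exc: "card reflect_exc \<le> 4 * h"
proof -
  define B where "B = {x \<in> A. x < M \<and> M - x \<in> A}"
  define E where "E = {x \<in> {1..<M}. x \<notin> A \<and> M - x \<notin> A}"
  define A' where "A' = (\<lambda>x. M - x) ` (A - {M})"
  have B: "card B \<le> h" unfolding B_def by (rule few_diffs[OF M(1)])
  have lt: "x < M" "1 \<le> x" if "x \<in> A - {M}" for x using M(2)[of x] that by auto
  have "card A' = card (A - {M})"
    unfolding A'_def by (rule card_image) (auto simp: inj_on_def dest!: lt(1))
  hence cA': "card A' = card A - 1" using M finA by simp
  have "(A - {M}) \<inter> A' \<subseteq> B"
  proof
    fix x assume x: "x \<in> (A - {M}) \<inter> A'"
    then obtain y where "y \<in> A - {M}" "x = M - y" by (auto simp: A'_def)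
    thus "x \<in> B" using x lt[of y] lt[of x] by (auto simp: B_def)
  qed
  hence "card ((A - {M}) \<inter> A') \<le> h"
    using B card_mono[of B "(A - {M}) \<inter> A'"] finA by (simp add: B_def)
  moreover have "card ((A - {M}) \<union> A') + card ((A - {M}) \<inter> A') = card (A - {M}) + card A'"
    by (rule card_Un_Int[symmetric]) (simp_all add: finA A'_def)
  moreover have "card ((A - {M}) \<union> A') + card E \<le> M - 1"
  proof -
    have "((A - {M}) \<union> A') \<inter> E = {}"
      using M(2) by (auto simp: E_def A'_def)
    hence "card ((A - {M}) \<union> A') + card E = card (((A - {M}) \<union> A') \<union> E)"
      by (intro card_Un_disjoint[symmetric]) (simp_all add: finA A'_def E_def)
    also have "\<dots> \<le> card {1..<M}"
    proof (rule card_mono)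
      show "A - {M} \<union> A' \<union> E \<subseteq> {1..<M}"
        using lt by (force simp: A'_def E_def)
    qed simp
    finally show ?thesis by simp
  qed
  moreover have "card (A - {M}) = card A - 1" using M finA by simp
  moreover have "card A \<ge> 1" using M(1) finA by (metis One_nat_def Suc_leI card_gt_0_iff empty_iff)
  ultimately have "card E \<le> 2 * h + 1" using cA' large by linarith
  moreover have "reflect_exc \<subseteq> B \<union> E" by (auto simp: reflect_exc_def B_def E_def)
  hence "card reflect_exc \<le> card (B \<union> E)"
    by (rule card_mono[rotated]) (simp add: B_def E_def finA)
  hence "card reflect_exc \<le> card B + card E" using card_Un_le[of B E] by linarith
  ultimately show ?thesis using B h by linarith
qed

text \<open>Both points in \<open>A\<close> is rare by \<open>few_sums\<close>. If neither is,
  reflection puts \<open>M - x\<close> and \<open>M - (x + a)\<close> into \<open>A\<close> up to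
  exceptions, and these again differ by \<open>a\<close>.\<close>

lemma card_shift_exc:
  assumes a: "a \<in> A"
  shows "card (shift_exc a) \<le> 10 * h"
proof -
  let ?S = "{x \<in> A. x + a \<in> A}"
  let ?R1 = "{x \<in> {1..<M - a}. x + a \<in> reflect_exc}"
  let ?R2 = "{x \<in> {1..<M - a}. M - (x + a) \<in> ?S}"
  have "shift_exc a \<subseteq> (?S \<union> reflect_exc) \<union> (?R1 \<union> ?R2)"
  proof
    fix x assume x: "x \<in> shift_exc a"
    hence x': "1 \<le> x" "x + a < M" and eq: "(x \<in> A) = (x + a \<in> A)" by (auto simp: shift_exc_def)
    show "x \<in> (?S \<union> reflect_exc) \<union> (?R1 \<union> ?R2)"
    proof (rule ccontr)
      assume *: "x \<notin> (?S \<union> reflect_exc) \<union> (?R1 \<union> ?R2)"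
      hence "x \<notin> A" "x + a \<notin> A" using eq by auto
      hence "M - x \<in> A" "M - (x + a) \<in> A" using * x' by (auto simp: reflect_exc_def)
      moreover have "M - (x + a) + a = M - x" using x' by simp
      ultimately show False using * x' by auto
    qed
  qed
  hence "card (shift_exc a) \<le> card ((?S \<union> reflect_exc) \<union> (?R1 \<union> ?R2))"
    by (rule card_mono[rotated]) (simp add: finA)
  also have "\<dots> \<le> (card ?S + card reflect_exc) + (card ?R1 + card ?R2)"
    by (intro order_trans[OF card_Un_le] add_mono card_Un_le)
  also have "\<dots> \<le> (h + 4 * h) + (4 * h + h)"
  proof (intro add_mono)
    have "card ?R1 \<le> card reflect_exc"
      by (rule card_inj_on_le[where f = "\<lambda>x. x + a"]) auto
    thus "card ?R1 \<le> 4 * h" using card_reflect_exc by linarith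
    have "card ?R2 \<le> card ?S"
      by (rule card_inj_on_le[where f = "\<lambda>x. M - (x + a)"]) (auto simp: inj_on_def finA)
    thus "card ?R2 \<le> h" using few_sums[OF a] by linarith
  qed (rule few_sums[OF a], rule card_reflect_exc)
  finally show ?thesis by simp
qed

text \<open>Fix one such \<open>a\<close>. For another such \<open>x\<close> other than
  \<open>M - a\<close>, \<open>x + a\<close> is rarely in \<open>A\<close>; otherwise its reflection
  \<open>M - (x + a)\<close> lies below the minimum, so neither is in \<open>A\<close>, which is
  rare too.\<close>

lemma few_small_if_min_large:
  assumes m: "\<And>a. a \<in> A \<Longrightarrow> m \<le> a" "M < 3 * m"
  shows "card {a \<in> A. 2 * a \<le> M} \<le> 6 * h"
proof (cases "{a \<in> A. 2 * a \<le> M} = {}")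
  case False
  then obtain a where a: "a \<in> A" "2 * a \<le> M" by blast
  let ?S = "{x \<in> A. x + a \<in> A}"
  let ?R = "{x. x + a < M \<and> M - (x + a) \<in> reflect_exc}"
  have finR: "finite ?R" by (rule finite_subset[of _ "{..M}"]) auto
  have "{x \<in> A. 2 * x \<le> M} \<subseteq> ?S \<union> ({M - a} \<union> ?R)"
  proof
    fix x assume x: "x \<in> {x \<in> A. 2 * x \<le> M}"
    show "x \<in> ?S \<union> ({M - a} \<union> ?R)"
    proof (cases "x + a \<in> A \<or> x + a \<ge> M")
      case True
      thus ?thesis using x a by auto
    next
      case F: False
      have "M - (x + a) < m" using m(1)[of x] m(1)[of a] m(2) x a by simp
      hence "M - (x + a) \<notin> A" using m(1) by fastforce
      thus ?thesis using F M(2)[OF a(1)] by (auto simp: reflect_exc_def)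
    qed
  qed
  hence "card {x \<in> A. 2 * x \<le> M} \<le> card (?S \<union> ({M - a} \<union> ?R))"
    by (rule card_mono[rotated]) (use finA finR in simp)
  also have "\<dots> \<le> card ?S + (card {M - a} + card ?R)"
    by (intro order_trans[OF card_Un_le] add_mono card_Un_le order_refl)
  also have "card ?R \<le> card reflect_exc"
    by (rule card_inj_on_le[where f = "\<lambda>x. M - (x + a)"]) (auto simp: inj_on_def)
  finally show ?thesis using few_sums[OF a(1)] card_reflect_exc h by simp
qed (simp only: card.empty)

text \<open>Nothing lies below \<open>m\<close>, so the shift by \<open>m\<close> puts nearly all of
  \<open>(m, 2 m)\<close> into \<open>A\<close> and keeps nearly all of \<open>(2 m, 3 m)\<close>
  out. But the shift by some \<open>a\<close> in \<open>A\<close> with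
  \<open>3 m / 2 \<le> a < 2 m\<close> forces much of \<open>(2 m, 3 m)\<close> into
  \<open>A\<close>.\<close>

lemma min_small:
  assumes m: "m \<in> A" "\<And>a. a \<in> A \<Longrightarrow> m \<le> a" "3 * m \<le> M"
  shows "m \<le> 62 * h"
proof (rule ccontr)
  assume "\<not> m \<le> 62 * h"
  hence big: "62 * h < m" by simp
  have notin: "x \<notin> A" if "x < m" for x using m(2)[of x] that by auto
  define B where "B = {x \<in> {1..<m}. x + m \<notin> A}"
  have "B \<subseteq> shift_exc m" using m(3) notin by (auto simp: B_def shift_exc_def)
  hence cB: "card B \<le> 10 * h"
    using card_mono[of "shift_exc m" B] card_shift_exc[OF m(1)] by simp
  have "A \<inter> {2 * m<..<3 * m} \<subseteq> (\<lambda>x. x + m) ` shift_exc m \<union> (\<lambda>x. x + 2 * m) ` B"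
  proof
    fix y assume y: "y \<in> A \<inter> {2 * m<..<3 * m}"
    show "y \<in> (\<lambda>x. x + m) ` shift_exc m \<union> (\<lambda>x. x + 2 * m) ` B"
    proof (cases "y - m \<in> A")
      case True
      hence "y - m \<in> shift_exc m" using y m(3) by (auto simp: shift_exc_def)
      thus ?thesis using y by (auto intro!: image_eqI[of y _ "y - m"])
    next
      case False
      moreover have "y - 2 * m + m = y - m" using y by auto
      ultimately have "y - 2 * m \<in> B" using y by (auto simp: B_def)
      thus ?thesis using y by (auto intro!: image_eqI[of y _ "y - 2 * m"])
    qed
  qed
  hence "card (A \<inter> {2 * m<..<3 * m}) \<le> card ((\<lambda>x. x + m) ` shift_exc m \<union> (\<lambda>x. x + 2 * m) ` B)"
    by (rule card_mono[rotated]) (simp add: B_def)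
  also have "\<dots> \<le> card ((\<lambda>x. x + m) ` shift_exc m) + card ((\<lambda>x. x + 2 * m) ` B)" by (rule card_Un_le)
  also have "\<dots> \<le> card (shift_exc m) + card B"
    by (intro add_mono card_image_le) (simp_all add: B_def)
  finally have c20: "card (A \<inter> {2 * m<..<3 * m}) \<le> 20 * h"
    using cB card_shift_exc[OF m(1)] by linarith
  have "\<not> {m div 2 + 1..<m} \<subseteq> B"
  proof
    assume "{m div 2 + 1..<m} \<subseteq> B"
    hence "card {m div 2 + 1..<m} \<le> card B" by (rule card_mono[rotated]) (simp add: B_def)
    thus False using cB big h by simp
  qed
  then obtain x0 where x0: "m div 2 < x0" "x0 < m" "x0 + m \<in> A" by (force simp: B_def)
  define a where "a = x0 + m"
  have a: "a \<in> A" "3 * m \<le> 2 * a" "a < 2 * m" using x0 by (auto simp: a_def)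
  have "{2 * m - a<..<m} \<subseteq> shift_exc a \<union> {x. x + a \<in> A \<inter> {2 * m<..<3 * m}}"
  proof
    fix x assume x: "x \<in> {2 * m - a<..<m}"
    show "x \<in> shift_exc a \<union> {x. x + a \<in> A \<inter> {2 * m<..<3 * m}}"
    proof (cases "x + a \<in> A")
      case False
      thus ?thesis using x a m(3) notin[of x] by (auto simp: shift_exc_def)
    qed (use x a in auto)
  qed
  moreover have fin: "finite {x. x + a \<in> A \<inter> {2 * m<..<3 * m}}"
    by (rule finite_subset[of _ "{..3 * m}"]) auto
  ultimately have "card {2 * m - a<..<m} \<le> card (shift_exc a \<union> {x. x + a \<in> A \<inter> {2 * m<..<3 * m}})"
    by (intro card_mono) auto
  also have "\<dots> \<le> card (shift_exc a) + card {x. x + a \<in> A \<inter> {2 * m<..<3 * m}}" by (rule card_Un_le)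
  also have "card {x. x + a \<in> A \<inter> {2 * m<..<3 * m}} \<le> card (A \<inter> {2 * m<..<3 * m})"
    by (rule card_inj_on_le[where f = "\<lambda>x. x + a"]) auto
  finally have "card {2 * m - a<..<m} \<le> 30 * h" using c20 card_shift_exc[OF a(1)] by linarith
  thus False using a big h by simp
qed

section \<open>A small element of \<open>A\<close>: parity\<close>

context
  fixes m W :: nat
  assumes m: "m \<in> A" "m \<le> 62 * h" and MW: "8 * W \<le> M" "M < 8 * W + 8" and W: "250 * h \<le> W"
begin

text \<open>Up to \<open>shift_exc m\<close>, one of \<open>x\<close>, \<open>x + m\<close> is in
  \<open>A\<close>, and moving the interval by \<open>m \<le> 62 h\<close> changes its count by at
  most \<open>m\<close>.\<close>

lemma half_density:
  assumes "u + l + m < M"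
  shows "l \<le> 2 * card (A \<inter> {u<..u + l}) + 72 * h"
proof -
  have "{u<..u + l} \<subseteq> (shift_exc m \<union> (A \<inter> {u<..u + l})) \<union> {x \<in> {u<..u + l}. x + m \<in> A}"
    using assms by (auto simp: shift_exc_def)
  hence "card {u<..u + l} \<le> card ((shift_exc m \<union> (A \<inter> {u<..u + l})) \<union> {x \<in> {u<..u + l}. x + m \<in> A})"
    by (rule card_mono[rotated]) simp
  also have "\<dots> \<le> (card (shift_exc m) + card (A \<inter> {u<..u + l})) + card {x \<in> {u<..u + l}. x + m \<in> A}"
    by (intro order_trans[OF card_Un_le] add_mono card_Un_le order_refl)
  also have "card {x \<in> {u<..u + l}. x + m \<in> A} \<le> card ((A \<inter> {u<..u + l}) \<union> {u + l<..u + l + m})"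
    by (rule card_inj_on_le[where f = "\<lambda>x. x + m"]) auto
  also have "\<dots> \<le> card (A \<inter> {u<..u + l}) + card {u + l<..u + l + m}" by (rule card_Un_le)
  finally show ?thesis using card_shift_exc[OF m(1)] m(2) by simp
qed

text \<open>Outside of few exceptional \<open>x\<close>, membership of \<open>x\<close> and \<open>x + b\<close> in \<open>A\<close> agrees if \<open>diff_in b\<close> and differs
  otherwise. Hence \<open>diff_in\<close> is multiplicative without exceptions, i.e. a quadratic character, and as it
  fails on small elements of \<open>A\<close> it must be parity.\<close>

definition diff_in :: "nat \<Rightarrow> bool" where
  "diff_in b \<longleftrightarrow> (\<exists>a\<in>A. a \<le> 2 * W \<and> a + b \<in> A)"

definition char_exc :: "nat \<Rightarrow> nat set" where
  "char_exc b = {x \<in> {1..2 * W}. ((x \<in> A) = (x + b \<in> A)) \<noteq> diff_in b}"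

lemma finite_char_exc [simp]: "finite (char_exc b)"
  by (simp add: char_exc_def)

text \<open>If \<open>a\<close> and \<open>a + b\<close> are in \<open>A\<close>, then
  \<open>x\<close> and \<open>x + b\<close> are both compared with \<open>x + a + b\<close> and two
  swaps cancel. Otherwise \<open>A\<close> and its translate by \<open>- b\<close> are disjoint in
  \<open>[1, 2 W]\<close>, both of density about 1/2, so they nearly partition it.\<close>

lemma card_char_exc:
  assumes b: "b \<le> W"
  shows "card (char_exc b) \<le> 72 * h"
proof (cases "diff_in b")
  case True
  then obtain a where a: "a \<in> A" "a \<le> 2 * W" "a + b \<in> A" by (auto simp: diff_in_def)
  have "char_exc b \<subseteq> shift_exc (a + b) \<union> {x. x + b \<in> shift_exc a}"
  proof
    fix x assume "x \<in> char_exc b"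
    hence x: "1 \<le> x" "x \<le> 2 * W" "(x \<in> A) \<noteq> (x + b \<in> A)" using True by (auto simp: char_exc_def)
    have "x + b + a < M" using x a b MW W h by linarith
    thus "x \<in> shift_exc (a + b) \<union> {x. x + b \<in> shift_exc a}"
      using x by (auto simp: shift_exc_def ac_simps)
  qed
  moreover have fin: "finite {x. x + b \<in> shift_exc a}"
    by (rule finite_subset[of _ "{..M}"]) (auto simp: shift_exc_def)
  ultimately have "card (char_exc b) \<le> card (shift_exc (a + b) \<union> {x. x + b \<in> shift_exc a})"
    by (intro card_mono) auto
  also have "\<dots> \<le> card (shift_exc (a + b)) + card {x. x + b \<in> shift_exc a}" by (rule card_Un_le)
  also have "card {x. x + b \<in> shift_exc a} \<le> card (shift_exc a)"
    by (rule card_inj_on_le[where f = "\<lambda>x. x + b"]) auto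
  finally show ?thesis using card_shift_exc[OF a(1)] card_shift_exc[OF a(3)] by linarith
next
  case False
  define B where "B = {x \<in> {0<..2 * W}. x + b \<in> A}"
  have lt: "0 + 2 * W + m < M" "b + 2 * W + m < M" using b m(2) MW W h by linarith+
  have "card (A \<inter> {b<..b + 2 * W}) \<le> card B"
    by (rule card_inj_on_le[where f = "\<lambda>x. x - b"]) (auto simp: B_def inj_on_def)
  hence "2 * W \<le> card (A \<inter> {0<..2 * W}) + card B + 72 * h"
    using half_density[OF lt(1)] half_density[OF lt(2)] by simp
  moreover have "card (A \<inter> {0<..2 * W}) + card B + card (char_exc b) \<le> 2 * W"
  proof -
    have "card (A \<inter> {0<..2 * W}) + card B = card ((A \<inter> {0<..2 * W}) \<union> B)"
      by (rule card_Un_disjoint[symmetric]) (use False in \<open>auto simp: B_def diff_in_def\<close>)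
    moreover have "card ((A \<inter> {0<..2 * W}) \<union> B) + card (char_exc b) = card (((A \<inter> {0<..2 * W}) \<union> B) \<union> char_exc b)"
      by (rule card_Un_disjoint[symmetric]) (use False in \<open>auto simp: B_def diff_in_def char_exc_def\<close>)
    moreover have "\<dots> \<le> card {0<..2 * W}"
      by (rule card_mono) (auto simp: B_def char_exc_def)
    ultimately show ?thesis by simp
  qed
  ultimately show ?thesis by linarith
qed

text \<open>The three exceptional sets have at most \<open>216 h < W\<close> elements together, so
  some \<open>x\<close> in \<open>[1, W]\<close> obeys all three rules.\<close>

lemma diff_in_add:
  assumes "b + c \<le> W"
  shows "diff_in (b + c) = (diff_in b = diff_in c)"
proof (rule ccontr)
  assume neq: "diff_in (b + c) \<noteq> (diff_in b = diff_in c)"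
  have "{1..W} \<subseteq> (char_exc b \<union> char_exc (b + c)) \<union> {x. x + b \<in> char_exc c}"
  proof
    fix x assume x: "x \<in> {1..W}"
    hence "((x \<in> A) = (x + b \<in> A)) = diff_in b" if "x \<notin> char_exc b"
      using that by (auto simp: char_exc_def)
    moreover have "((x \<in> A) = (x + b + c \<in> A)) = diff_in (b + c)" if "x \<notin> char_exc (b + c)"
      using that x by (auto simp: char_exc_def add.assoc)
    moreover have "((x + b \<in> A) = (x + b + c \<in> A)) = diff_in c" if "x + b \<notin> char_exc c"
      using that x assms by (auto simp: char_exc_def)
    ultimately show "x \<in> (char_exc b \<union> char_exc (b + c)) \<union> {x. x + b \<in> char_exc c}"
      using neq by blast
  qed
  moreover have fin: "finite {x. x + b \<in> char_exc c}"
    by (rule finite_subset[of _ "{..2 * W}"]) (auto simp: char_exc_def)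
  ultimately have "card {1..W} \<le> card ((char_exc b \<union> char_exc (b + c)) \<union> {x. x + b \<in> char_exc c})"
    by (intro card_mono) auto
  also have "\<dots> \<le> (card (char_exc b) + card (char_exc (b + c))) + card {x. x + b \<in> char_exc c}"
    by (intro order_trans[OF card_Un_le] add_mono card_Un_le order_refl)
  also have "card {x. x + b \<in> char_exc c} \<le> card (char_exc c)"
    by (rule card_inj_on_le[where f = "\<lambda>x. x + b"]) auto
  finally show False
    using card_char_exc[of b] card_char_exc[of c] card_char_exc[of "b + c"] assms W h by simp
qed

text \<open>Shifting by an element of \<open>A\<close> mostly swaps membership, while
  \<open>diff_in\<close> mostly preserves it; \<open>82 h\<close> exceptions cannot cover
  \<open>[1, 2 W]\<close>.\<close>

lemma not_diff_in:
  assumes a: "a \<in> A" "a \<le> W"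
  shows "\<not> diff_in a"
proof
  assume d: "diff_in a"
  have "{1..2 * W} \<subseteq> char_exc a \<union> shift_exc a"
    using d a(2) MW W h by (auto simp: char_exc_def shift_exc_def)
  hence "card {1..2 * W} \<le> card (char_exc a \<union> shift_exc a)" by (rule card_mono[rotated]) simp
  also have "\<dots> \<le> card (char_exc a) + card (shift_exc a)" by (rule card_Un_le)
  finally show False using card_char_exc[OF a(2)] card_shift_exc[OF a(1)] W h by simp
qed

text \<open>Otherwise additivity spreads \<open>diff_in\<close> to all of \<open>[1, W]\<close>,
  including the element \<open>m\<close> of \<open>A\<close>.\<close>

lemma not_diff_in_1: "\<not> diff_in 1"
proof
  assume 1: "diff_in 1"
  have "diff_in b" if "1 \<le> b" "b \<le> W" for b
    using that
  proof (induction b rule: dec_induct)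
    case (step b)
    thus ?case using 1 diff_in_add[of b 1] by simp
  qed (use 1 in simp)
  moreover have "1 \<le> m" "m \<le> W" using m M(2)[of m] W h by linarith+
  ultimately show False using not_diff_in[OF m(1)] by blast
qed

lemma diff_in_iff_even: "1 \<le> b \<Longrightarrow> b \<le> W \<Longrightarrow> diff_in b \<longleftrightarrow> even b"
proof (induction b rule: dec_induct)
  case (step b)
  thus ?case using not_diff_in_1 diff_in_add[of b 1] by simp
qed (use not_diff_in_1 in simp)

text \<open>Elements up to \<open>W\<close> are odd, and half density puts nearly all odd numbers up
  to \<open>W\<close> into \<open>A\<close>. Shifts by an odd \<open>a\<close> swap both parity and
  membership and carry this up to \<open>M\<close>, adding at most \<open>10 h\<close> errors each
  time.\<close>

lemma few_evens_if_min_small: "card {a \<in> A. even a} \<le> 1809 * h"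
proof -
  have odd: "odd a" if "a \<in> A" "a \<le> W" for a
    using not_diff_in[OF that] diff_in_iff_even[of a] M(2)[of a] that by auto
  have "W div 2 + (W - W div 2) + m < M" using m(2) MW W h by linarith
  from half_density[OF this] have "0 < card (A \<inter> {W div 2<..W})" using W h by simp
  hence "A \<inter> {W div 2<..W} \<noteq> {}" by force
  then obtain a where a: "a \<in> A" "W div 2 < a" "a \<le> W" by auto
  define Bad where "Bad = {x \<in> {1..<M}. (x \<in> A) \<noteq> odd x}"
  define C where "C k = {x \<in> Bad. k * a < x \<and> x \<le> k * a + a}" for k
  have C0: "card (C 0) \<le> 38 * h"
  proof -
    have "0 + W + m < M" using m(2) MW W h by linarith
    from half_density[OF this] have "W \<le> 2 * card (A \<inter> {0<..W}) + 72 * h" by simp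
    moreover have "card (C 0) + card (A \<inter> {0<..W}) \<le> card ((\<lambda>j. 2 * j + 1) ` {..<(W + 1) div 2})"
    proof -
      have "card (C 0) + card (A \<inter> {0<..W}) = card (C 0 \<union> (A \<inter> {0<..W}))"
        by (rule card_Un_disjoint[symmetric]) (use odd a in \<open>auto simp: C_def Bad_def\<close>)
      also have "\<dots> \<le> card ((\<lambda>j. 2 * j + 1) ` {..<(W + 1) div 2})"
      proof (rule card_mono)
        show "C 0 \<union> A \<inter> {0<..W} \<subseteq> (\<lambda>j. 2 * j + 1) ` {..<(W + 1) div 2}"
        proof
          fix x assume "x \<in> C 0 \<union> A \<inter> {0<..W}"
          hence "odd x" "x \<le> W" using odd a by (auto simp: C_def Bad_def)
          then obtain j where "x = 2 * j + 1" by (blast elim: oddE)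
          moreover from this have "j < (W + 1) div 2" using \<open>x \<le> W\<close> by linarith
          ultimately show "x \<in> (\<lambda>j. 2 * j + 1) ` {..<(W + 1) div 2}" by blast
        qed
      qed simp
      finally show ?thesis .
    qed
    moreover have "card ((\<lambda>j. 2 * j + 1) ` {..<(W + 1) div 2}) \<le> (W + 1) div 2"
      using card_image_le[of "{..<(W + 1) div 2}" "\<lambda>j. 2 * j + 1"] by simp
    ultimately show ?thesis using h by linarith
  qed
  have C: "card (C k) \<le> 38 * h + 10 * h * k" for k
  proof (induction k)
    case (Suc k)
    have "C (Suc k) \<subseteq> (\<lambda>x. x + a) ` (C k \<union> shift_exc a)"
    proof
      fix x assume x: "x \<in> C (Suc k)"
      hence y: "a < x" "x < M" "(x \<in> A) \<noteq> odd x" "k * a < x - a" "x - a \<le> k * a + a"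
        by (auto simp: C_def Bad_def)
      have "x - a \<in> C k \<union> shift_exc a"
      proof (rule ccontr)
        assume "x - a \<notin> C k \<union> shift_exc a"
        hence "(x - a \<in> A) = odd (x - a)" "(x - a \<in> A) \<noteq> (x \<in> A)"
          using y by (auto simp: C_def Bad_def shift_exc_def)
        moreover have "odd (x - a) \<noteq> odd x" using y(1) odd[OF a(1,3)] by simp
        ultimately show False using y(3) by blast
      qed
      thus "x \<in> (\<lambda>x. x + a) ` (C k \<union> shift_exc a)"
        using y(1) by (intro image_eqI[of x _ "x - a"]) auto
    qed
    hence "card (C (Suc k)) \<le> card ((\<lambda>x. x + a) ` (C k \<union> shift_exc a))"
      by (rule card_mono[rotated]) (simp add: C_def Bad_def)
    also have "\<dots> \<le> card (C k \<union> shift_exc a)" by (rule card_image_le) (simp add: C_def Bad_def)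
    also have "\<dots> \<le> card (C k) + card (shift_exc a)" by (rule card_Un_le)
    finally show ?case using Suc.IH card_shift_exc[OF a(1)] by simp
  qed (use C0 in simp)
  have "{a \<in> A. even a} \<subseteq> insert M (\<Union>k<16. C k)"
  proof
    fix x assume x: "x \<in> {a \<in> A. even a}"
    show "x \<in> insert M (\<Union>k<16. C k)"
    proof (cases "x = M")
      case False
      define k where "k = (x - 1) div a"
      have x': "1 \<le> x" "x < M" using x False M(2)[of x] by auto
      have "k * a + (x - 1) mod a = x - 1" unfolding k_def by (rule div_mult_mod_eq)
      moreover have "(x - 1) mod a < a" using a by simp
      ultimately have "k * a \<le> x - 1" "x - 1 < k * a + a" by linarith+
      hence "k * a < x" "x \<le> k * a + a" using x' by linarith+
      \<comment> \<open>\<open>2 a \<ge> W + 1\<close> gives \<open>16 a \<ge> 8 W + 8 > M\<close>,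
        so sixteen blocks of length \<open>a\<close> suffice.\<close>
      moreover have "x - 1 < 16 * a" using a x' MW by linarith
      hence "k < 16" unfolding k_def using a by (simp add: less_mult_imp_div_less)
      ultimately show ?thesis using x x' by (auto simp: C_def Bad_def)
    qed simp
  qed
  hence "card {a \<in> A. even a} \<le> card (insert M (\<Union>k<16. C k))"
    by (rule card_mono[rotated]) (simp add: C_def Bad_def)
  also have "\<dots> \<le> Suc (card (\<Union>k<16. C k))" by (rule card_insert_le_m1) (simp_all add: C_def Bad_def)
  also have "card (\<Union>k<16. C k) \<le> (\<Sum>k<16. card (C k))" by (rule card_UN_le) simp
  also have "\<dots> \<le> (\<Sum>k<16. 38 * h + 10 * h * k)" by (intro sum_mono C)
  also have "\<dots> = 608 * h + 10 * h * (\<Sum>k<16. k)" by (simp add: sum.distrib sum_distrib_left)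
  also have "(\<Sum>k<16. k) = (120 :: nat)" by (simp add: numeral_eq_Suc)
  also have "608 * h + 10 * h * 120 = 1808 * h" by simp
  finally show ?thesis using h by simp
qed

end

text \<open>\<open>A\<close> and its reflection are nearly disjoint. This serves to show that the
  maximum is close to \<open>n\<close>.\<close>

lemma two_card_le: "2 * card A \<le> M + 1 + 4 * h"
proof -
  define B where "B = A - {M} - reflect_exc"
  have lt: "x < M" "1 \<le> x" if "x \<in> A - {M}" for x using M(2)[of x] that by auto
  have "card (A - {M}) + card ((\<lambda>x. M - x) ` B) = card ((A - {M}) \<union> (\<lambda>x. M - x) ` B)"
  proof (rule card_Un_disjoint[symmetric])
    show "(A - {M}) \<inter> (\<lambda>x. M - x) ` B = {}"
      using lt by (auto simp: B_def reflect_exc_def)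
  qed (simp_all add: finA B_def)
  also have "\<dots> \<le> card {1..<M}"
  proof (rule card_mono)
    have "A - {M} \<subseteq> {1..<M}" unfolding subset_iff atLeastLessThan_iff using lt by blast
    moreover have "(\<lambda>x. M - x) ` {1..<M} \<subseteq> {1..<M}" by auto
    ultimately show "(A - {M}) \<union> (\<lambda>x. M - x) ` B \<subseteq> {1..<M}" by (auto simp: B_def)
  qed simp
  also have "card ((\<lambda>x. M - x) ` B) = card B"
    by (rule card_image) (auto simp: inj_on_def B_def dest!: lt(1)[OF DiffI])
  finally have "card (A - {M}) + card B \<le> M - 1" by simp
  moreover have "card (A - {M}) \<le> card B + card reflect_exc"
    unfolding B_def by (simp add: card_le_sym_Diff diff_card_le_card_Diff flip: le_diff_conv)
  moreover have "card (A - {M}) = card A - 1" using M finA by simp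
  ultimately show ?thesis using card_reflect_exc h by linarith
qed

text \<open>The minimum decides: if it is at most \<open>M / 3\<close>, \<open>min_small\<close>
  pushes it down to \<open>62 h\<close>, where the parity argument applies.\<close>

lemma odd_or_upper_half:
  assumes "M \<ge> 2000 * h"
  shows "card {a \<in> A. even a} \<le> 1809 * h \<or> card {a \<in> A. 2 * a \<le> M} \<le> 6 * h"
proof -
  define m where "m = Min A"
  have m: "m \<in> A" "\<And>a. a \<in> A \<Longrightarrow> m \<le> a" using M(1) finA by (auto simp: m_def intro!: Min_in)
  show ?thesis
  proof (cases "M < 3 * m")
    case True
    thus ?thesis using few_small_if_min_large m by blast
  next
    case False
    hence "m \<le> 62 * h" using min_small m by simp
    hence "card {a \<in> A. even a} \<le> 1809 * h"
      by (rule few_evens_if_min_small[of m "M div 8", OF m(1)]) (use assms in linarith)+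
    thus ?thesis by blast
  qed
qed

end

text \<open>Deleting the elements that occur in more than \<open>h\<close> pairs, as a summand
  (\<open>D1\<close>) or as the sum (\<open>D2\<close>), costs at most \<open>h / 2\<close> elements
  and leaves an instance of \<open>almost_sum_free\<close>.\<close>

lemma few_schur_pairs_imp_odd_or_upper_half:
  assumes A: "A \<subseteq> {1..n}" "n \<le> 2 * card A" and h: "1 \<le> h" "5000 * h \<le> n"
    and few: "4 * card {(a, b) \<in> A \<times> A. a + b \<in> A} \<le> h * h"
  shows "card {a \<in> A. even a} \<le> 1810 * h \<or> card {a \<in> A. a < (n + 1) div 2} \<le> 11 * h"
proof -
  define P where "P = {(a, b) \<in> A \<times> A. a + b \<in> A}"
  define D1 where "D1 = {a \<in> A. h < card {x \<in> A. x + a \<in> A}}"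
  define D2 where "D2 = {a \<in> A. h < card {x \<in> A. x < a \<and> a - x \<in> A}}"
  define A' where "A' = A - (D1 \<union> D2)"
  have finA: "finite A" using A finite_subset by blast
  have finP: "finite P" unfolding P_def by (rule finite_subset[of _ "A \<times> A"]) (use finA in auto)
  have fin: "finite D1" "finite D2" "finite A'" using finA by (simp_all add: D1_def D2_def A'_def)
  have "h * card D1 = (\<Sum>a\<in>D1. h)" by simp
  also have "\<dots> \<le> (\<Sum>a\<in>D1. card {x \<in> A. x + a \<in> A})" by (intro sum_mono) (simp add: D1_def)
  also have "\<dots> = card (SIGMA a:D1. {x \<in> A. x + a \<in> A})" using fin finA by simp
  also have "\<dots> \<le> card P"
    by (rule card_inj_on_le[where f = "\<lambda>(a, x). (x, a)"]) (use finP in \<open>auto simp: inj_on_def P_def D1_def\<close>)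
  finally have D1: "h * card D1 \<le> card P" .
  have "h * card D2 = (\<Sum>a\<in>D2. h)" by simp
  also have "\<dots> \<le> (\<Sum>a\<in>D2. card {x \<in> A. x < a \<and> a - x \<in> A})" by (intro sum_mono) (simp add: D2_def)
  also have "\<dots> = card (SIGMA a:D2. {x \<in> A. x < a \<and> a - x \<in> A})" using fin finA by simp
  also have "\<dots> \<le> card P"
    by (rule card_inj_on_le[where f = "\<lambda>(a, x). (x, a - x)"]) (use finP in \<open>auto simp: inj_on_def P_def D2_def\<close>)
  finally have D2: "h * card D2 \<le> card P" .
  have "h * (2 * (card D1 + card D2)) \<le> h * h"
    using D1 D2 few unfolding P_def[symmetric] by (simp add: algebra_simps)
  hence D: "2 * (card D1 + card D2) \<le> h" using h by simp
  hence D': "card D1 + card D2 \<le> h" by simp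
  have A_le: "card {a \<in> A. Q a} \<le> card {a \<in> A'. Q a} + (card D1 + card D2)" for Q
  proof -
    have "card {a \<in> A. Q a} \<le> card ({a \<in> A'. Q a} \<union> (D1 \<union> D2))"
      by (rule card_mono) (use fin in \<open>auto simp: A'_def\<close>)
    also have "\<dots> \<le> card {a \<in> A'. Q a} + (card D1 + card D2)"
      by (intro order_trans[OF card_Un_le] add_mono card_Un_le order_refl)
    finally show ?thesis .
  qed
  have cA': "card A \<le> card A' + (card D1 + card D2)" using A_le[of "\<lambda>_. True"] by simp
  hence cA'_ge: "n \<le> 2 * card A' + h" using A(2) D by simp
  have "A' \<noteq> {}"
  proof
    assume "A' = {}"
    thus False using cA'_ge h by simp
  qed
  define M where "M = Max A'"
  have M: "M \<in> A'" "a \<le> M" if "a \<in> A'" for a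
    using fin \<open>A' \<noteq> {}\<close> that by (simp_all add: M_def)
  have Mn: "M \<le> n" using Max_in[OF fin(3) \<open>A' \<noteq> {}\<close>] A by (auto simp: M_def A'_def)
  interpret almost_sum_free A' h M
  proof
    show "M \<in> A'" using fin \<open>A' \<noteq> {}\<close> by (simp add: M_def)
    show "1 \<le> a \<and> a \<le> M" if "a \<in> A'" for a using M(2)[OF that] that A by (auto simp: A'_def)
    show "1 \<le> h" by fact
    show "M \<le> 2 * card A' + h" using Mn cA'_ge by linarith
    fix a assume a: "a \<in> A'"
    have "card {x \<in> A'. x + a \<in> A'} \<le> card {x \<in> A. x + a \<in> A}"
      by (rule card_mono) (use finA in \<open>auto simp: A'_def\<close>)
    also have "\<dots> \<le> h" using a by (auto simp: A'_def D1_def)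
    finally show "card {x \<in> A'. x + a \<in> A'} \<le> h" .
    have "card {x \<in> A'. x < a \<and> a - x \<in> A'} \<le> card {x \<in> A. x < a \<and> a - x \<in> A}"
      by (rule card_mono) (use finA in \<open>auto simp: A'_def\<close>)
    also have "\<dots> \<le> h" using a by (auto simp: A'_def D2_def)
    finally show "card {x \<in> A'. x < a \<and> a - x \<in> A'} \<le> h" .
  qed
  have M_ge: "n \<le> M + 6 * h" using two_card_le cA'_ge h by linarith
  have "2000 * h \<le> M" using M_ge assms(4) by linarith
  from odd_or_upper_half[OF this] show ?thesis
  proof
    assume "card {a \<in> A'. even a} \<le> 1809 * h"
    thus ?thesis using A_le[of even] D' by linarith
  next
    assume *: "card {a \<in> A'. 2 * a \<le> M} \<le> 6 * h"
    have "{a \<in> A'. a < (n + 1) div 2} \<subseteq> {a \<in> A'. 2 * a \<le> M} \<union> {M div 2<..<(n + 1) div 2}"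
      by auto
    hence "card {a \<in> A'. a < (n + 1) div 2} \<le> card ({a \<in> A'. 2 * a \<le> M} \<union> {M div 2<..<(n + 1) div 2})"
      by (rule card_mono[rotated]) (simp add: fin)
    also have "\<dots> \<le> card {a \<in> A'. 2 * a \<le> M} + card {M div 2<..<(n + 1) div 2}" by (rule card_Un_le)
    \<comment> \<open>The halves of \<open>M\<close> and \<open>n\<close> differ by at most
      \<open>3 h\<close> up to rounding.\<close>
    also have "card {M div 2<..<(n + 1) div 2} \<le> 4 * h"
      using M_ge h by simp
    finally show ?thesis using * A_le[of "\<lambda>a. a < (n + 1) div 2"] D' by linarith
  qed
qed

section \<open>Combining the cases\<close>

text \<open>Since \<open>A\<close> has more than \<open>N\<close> elements, the \<open>m\<close>
  missing ones are compensated by at least \<open>m\<close> elements below \<open>N\<close>: either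
  \<open>m / 8\<close> of these are far from \<open>N\<close> or \<open>7 m / 8\<close> are
  near.\<close>

lemma upper_half_hit:
  fixes q :: real and n :: nat
  defines "N \<equiv> (n + 1) div 2"
  assumes q: "0 < q" "q \<le> 1" and A: "A \<subseteq> {1..n}" "N + 1 \<le> card A"
    and m: "m = card ({N..n} - A)" "200 * m \<le> n"
    and mq: "real m * q \<ge> 10 ^ 51"
  shows "measure_pmf.prob (random_subset n q) {R. schur (A \<union> R)} \<ge> 1 / 2"
proof -
  define far where "far = {a \<in> A. a + 20 * m \<le> N}"
  define near where "near = {a \<in> A. N < a + 20 * m \<and> a < N}"
  have finA: "finite A" using A finite_subset by blast
  have m1: "m \<ge> 1" using mq by (cases m) auto
  have mq32: "real m * q \<ge> 32" using mq by simp
  have "card {N..n} = card (A \<inter> {N..n}) + card ({N..n} - A)"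
    using card_Int_Diff[of "{N..n}" A] by (simp add: Int_commute)
  moreover have "A = (A \<inter> {N..n}) \<union> (far \<union> near)"
    using A(1) m1 by (auto simp: far_def near_def)
  from arg_cong[where f = card, OF this] have "card A \<le> card (A \<inter> {N..n}) + (card far + card near)"
    using card_Un_le[of "A \<inter> {N..n}" "far \<union> near"] card_Un_le[of far near] by linarith
  moreover have "card {N..n} = n + 1 - N" "n \<le> 2 * N" "N \<le> n + 1" by (auto simp: N_def)
  ultimately have "m \<le> card far + card near" using A(2) m(1) by linarith
  hence "m \<le> 8 * card far \<or> 7 * m \<le> 8 * card near" by linarith
  thus ?thesis
  proof
    assume "m \<le> 8 * card far"
    thus ?thesis unfolding far_def N_def
      by (intro far_below_half_hit[OF q A(1) _ m1 mq32]) (use m in \<open>auto simp: N_def\<close>)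
  next
    assume "7 * m \<le> 8 * card near"
    thus ?thesis unfolding near_def N_def
    proof (intro near_half_hit[OF q A(1) _ m1])
      have "100 * x \<ge> 6912 * 10 ^ 48" if "x \<ge> 10 ^ 51" for x :: real using that by simp
      thus "100 * (real m * q) \<ge> 6912 * 10 ^ 48" using mq by blast
    qed (use m in \<open>auto simp: N_def\<close>)
  qed
qed

lemma schur_hit:
  fixes q :: real and n :: nat
  defines "N \<equiv> (n + 1) div 2"
  assumes q: "0 < q" "q \<le> 1" and A: "A \<subseteq> {1..n}" "N + 1 \<le> card A"
    and nq: "real n * q \<ge> 10 ^ 230"
    and mq: "real (card ({N..n} - A)) * q \<ge> 10 ^ 51"
    and evens: "real (card {a \<in> A. even a}) * real n * q\<^sup>2 \<ge> 10 ^ 51"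
  shows "measure_pmf.prob (random_subset n q) {R. schur (A \<union> R)} \<ge> 1 / 2"
proof -
  \<comment> \<open>\<open>h\<close> is the error level of the stability result; \<open>g\<close> is
    chosen so that \<open>2 g n \<le> h^2 / 4\<close>, the number of pairs exceeded when there are
    many.\<close>
  define h where "h = n div 10 ^ 6"
  define g where "g = h * h div (8 * n)"
  have "real n * q \<le> real n * 1" using q by (intro mult_left_mono) auto
  hence n_ge: "real n \<ge> 10 ^ 230" using nq by linarith
  have n15: "real n \<ge> 10 ^ 15" by (rule order_trans[OF _ n_ge]) (rule power_increasing, simp_all)
  hence n: "n \<ge> 10 ^ 15" by (metis of_nat_le_iff of_nat_numeral of_nat_power)
  have h: "h \<ge> 1" "5000 * h \<le> n" "10 ^ 6 * h \<le> n" "n \<le> 10 ^ 6 * h + 10 ^ 6"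
    using n unfolding h_def by simp_all
  show ?thesis
  proof (cases "4 * card {(a, b) \<in> A \<times> A. a + b \<in> A} \<le> h * h")
    case False
    show ?thesis
    proof (rule many_schur_pairs_hit[OF q A(1), where \<gamma> = "1 / 10 ^ 14" and g = g])
      have "8 * n * g \<le> h * h" unfolding g_def by simp
      thus "2 * g * n \<le> card {(a, b) \<in> A \<times> A. a + b \<in> A}" using False by (simp add: mult_ac)
      have "h * h \<le> n * n" using h(3) by (intro mult_mono) simp_all
      also have "\<dots> \<le> n * (8 * n)" by simp
      finally have "g \<le> n * (8 * n) div (8 * n)" unfolding g_def by (rule div_le_mono)
      thus "g \<le> n" using n by simp
      have hn: "real n \<le> 2 * 10 ^ 6 * real h"
      proof -
        have "n \<le> 2 * 10 ^ 6 * h" using h(1,4) by simp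
        from of_nat_mono[OF this, where ?'a = real] show ?thesis by simp
      qed
      have "h * h < 8 * n * (g + 1)"
        using dividend_less_times_div[of "8 * n" "h * h"] n
        unfolding g_def by (simp add: algebra_simps)
      from of_nat_less_iff[where ?'a = real, THEN iffD2, OF this]
      have "real h * real h < 8 * real n * (real g + 1)" by (simp add: distrib_left)
      moreover have "real n * real n \<le> (2 * 10 ^ 6 * real h) * (2 * 10 ^ 6 * real h)"
        using hn by (intro mult_mono) auto
      ultimately have "real n * real n < 32 * 10 ^ 12 * real n * (real g + 1)" by simp
      hence "real n * real n < real n * (32 * 10 ^ 12 * (real g + 1))" by (simp add: mult_ac)
      hence "real n < 32 * 10 ^ 12 * (real g + 1)" by (rule mult_left_less_imp_less) simp
      thus "1 / 10 ^ 14 * real n \<le> real g" using n15 by simp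
      \<comment> \<open>The power is \<open>10^224\<close>; the exponent 230 leaves room for
        6912.\<close>
      have "6912 / (1 / 10 ^ 14) ^ 16 \<le> (10 :: real) ^ 230" by (simp add: power_one_over)
      thus "6912 / (1 / 10 ^ 14) ^ 16 \<le> real n * q" using nq by linarith
    qed simp
  next
    case True
    have "n \<le> 2 * card A" using A(2) by (simp add: N_def)
    from few_schur_pairs_imp_odd_or_upper_half[OF A(1) this h(1,2) True]
    show ?thesis
    proof
      assume *: "card {a \<in> A. even a} \<le> 1810 * h"
      show ?thesis
      proof (rule mostly_odd_hit[OF q _ A(1) \<open>n \<le> 2 * card A\<close>])
        show "n \<ge> 1000" using n by simp
        show "50 * card {a \<in> A. even a} \<le> n" using * h(3) by simp
        have "(1024 :: real) \<le> 10 ^ 230" "(1024 :: real) \<le> 10 ^ 51" by simp_all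
        thus "real n * q \<ge> 1024" "real (card {a \<in> A. even a}) * real n * q\<^sup>2 \<ge> 1024"
          using nq evens by linarith+
      qed
    next
      assume *: "card {a \<in> A. a < (n + 1) div 2} \<le> 11 * h"
      define m where "m = card ({N..n} - A)"
      have finA: "finite A" using A finite_subset by blast
      have "card {N..n} = card (A \<inter> {N..n}) + card ({N..n} - A)"
        using card_Int_Diff[of "{N..n}" A] by (simp add: Int_commute)
      moreover have "A = (A \<inter> {N..n}) \<union> {a \<in> A. a < (n + 1) div 2}"
        using A(1) by (auto simp: N_def)
      from arg_cong[where f = card, OF this] have "card A \<le> card (A \<inter> {N..n}) + card {a \<in> A. a < (n + 1) div 2}"
        using card_Un_le[of "A \<inter> {N..n}" "{a \<in> A. a < (n + 1) div 2}"] by linarith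
      moreover have "card {N..n} = n + 1 - N" "n \<le> 2 * N" "N \<le> n + 1" by (auto simp: N_def)
      ultimately have "m \<le> 11 * h" using * A(2) unfolding m_def by linarith
      hence "200 * m \<le> n" using h(2) by linarith
      thus ?thesis
        using upper_half_hit[OF q A(1), of m] A(2) mq unfolding N_def m_def by simp
    qed
  qed
qed

lemma nat_ceiling_half: "nat \<lceil>real n / 2\<rceil> = (n + 1) div 2"
proof -
  have "\<lceil>real n / 2\<rceil> = int ((n + 1) div 2)"
    by (rule ceiling_unique) linarith+
  thus ?thesis by simp
qed

theorem theorem1p5:
  fixes t :: "nat \<Rightarrow> nat" and A :: "nat \<Rightarrow> nat set" and q :: "nat \<Rightarrow> real"
  assumes "\<And>n. t n > 0"
    and "\<forall>\<^sub>F n in sequentially. A n \<subseteq> {1..n}"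
    and "\<forall>\<^sub>F n in sequentially. card (A n) = nat \<lceil>real n / 2\<rceil> + t n"
    and "\<And>n. 0 \<le> q n \<and> q n \<le> 1"
    and "q \<in> \<omega>(\<lambda>n. 1 / real n)"
    and "whp (\<lambda>n. random_subset n (q n)) (\<lambda>n. {S. \<not> schur (A n \<union> S)})"
  shows "\<exists>K>0. \<forall>\<^sub>F n in sequentially.
           real (card ({nat \<lceil>real n / 2\<rceil>..n} - A n)) \<le> K * (1 / q n) \<or>
           real (card {a \<in> A n. even a}) \<le> K * (1 / (q n)\<^sup>2) * (1 / real n)"
proof (intro exI conjI)
  \<comment> \<open>\<open>K\<close> is the threshold in \<open>schur_hit\<close>, which covers the
    bound \<open>6912 * 10^48\<close> at scale \<open>100 m\<close>. The threshold
    \<open>10^230\<close> is absorbed by the growth of \<open>n q\<close>.\<close>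
  show "(10 ^ 51 :: real) > 0" by simp
  have "\<forall>\<^sub>F n in sequentially. norm (q n) \<ge> 10 ^ 230 * norm (1 / real n)"
    by (rule landau_omega.smallD[OF assms(5)]) simp
  moreover have "\<forall>\<^sub>F n in sequentially. 1 / 2 < measure_pmf.prob (random_subset n (q n)) {S. \<not> schur (A n \<union> S)}"
    using assms(6) unfolding whp_def by (rule order_tendstoD) simp
  ultimately show "\<forall>\<^sub>F n in sequentially.
      real (card ({nat \<lceil>real n / 2\<rceil>..n} - A n)) \<le> 10 ^ 51 * (1 / q n) \<or>
      real (card {a \<in> A n. even a}) \<le> 10 ^ 51 * (1 / (q n)\<^sup>2) * (1 / real n)"
    using assms(2,3) eventually_gt_at_top[of 0]
  proof eventually_elim
    case (elim n)
    have nq: "real n * q n \<ge> 10 ^ 230"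
      using elim(1,5) assms(4)[of n] by (simp add: field_simps)
    hence q: "0 < q n" "q n \<le> 1" using assms(4)[of n] by (auto simp: order_less_le)
    show ?case
    proof (rule ccontr)
      \<comment> \<open>Both alternatives fail, so being Schur has probability at least 1/2, against
        more than 1/2 for its complement.\<close>
      assume neg: "\<not> ?thesis"
      have "measure_pmf.prob (random_subset n (q n)) {R. schur (A n \<union> R)} \<ge> 1 / 2"
      proof (rule schur_hit[OF q elim(3) _ nq])
        show "(n + 1) div 2 + 1 \<le> card (A n)"
          using elim(4) assms(1)[of n] by (simp add: nat_ceiling_half)
        show "10 ^ 51 \<le> real (card ({(n + 1) div 2..n} - A n)) * q n"
          using neg q by (simp add: nat_ceiling_half field_simps)
        show "10 ^ 51 \<le> real (card {a \<in> A n. even a}) * real n * (q n)\<^sup>2"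
          using neg q elim(5) by (simp add: nat_ceiling_half field_simps)
      qed
      moreover have "measure_pmf.prob (random_subset n (q n)) {S. \<not> schur (A n \<union> S)} =
          1 - measure_pmf.prob (random_subset n (q n)) {R. schur (A n \<union> R)}"
        by (subst measure_pmf.prob_compl[symmetric]) (auto intro: arg_cong2[where f = measure])
      ultimately show False using elim(2) by linarith
    qed
  qed
qed

end
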